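(* Let $d\in\mathbb N$, $\delta>0$, and let parameters $q^j_\pm>0$, $w^j_S<w^j_I$ ($j=1,\dots,d$) be given. Fix a strategy $i\in\{1,\dots,d\}$ and assume that for all $j\neq i$ $$\frac{w^j_I-w^i_I}{w^i_I-w^i_S}>\frac{q^j_+-q^i_+}{q^i_-+q^i_++\delta},\qquad \frac{w^j_S-w^i_S}{w^i_I-w^i_S}>\frac{q^i_--q^j_-}{q^i_-+q^i_++\delta}.$$ Assume moreover that for all $j\neq i$ $$q^j_+>q^i_+,\qquad q^i_->q^j_- .$$ Then for any $\lambda>0$ and all sufficiently small $\beta_{jk}$ the following holds. For any $T>t$, any initial distribution $x(t)$ and any terminal values $g_T=(g_T(jI),g_T(jS))_{j=1}^d$ such that $g_T(jI)-g_T(jS)\ge 0$ for all $j$, $g_T(iI)-g_T(iS)$ is sufficiently small, and $$g_T(iI)\le g_T(jI)\quad\text{and}\quad g_T(iS)\le g_T(jS),\qquad j\neq i,$$ there exists a unique solution $(x,u,g)$ to the discounted MFG consistency equation on $[t,T]$ (with initial distribution $x(t)$ and terminal payoff $g_T$) such that $u$ is stationary and equals $\hat u^i$ everywhere. Moreover, this solution is such that, for large $T-t$, $x(s)$ tends to the fixed point $\bar x$ for $s\to T$, and $g_s$ stays near the stationary solution $\bar g$ almost all time apart from a small initial period around $t$ and some final period around $T$. Here $(\bar x,\bar g)$ is the stationary solution associated with $\hat u^i$.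
   Context: Each agent has one of $2d$ states $jI$, $jS$, $j\in\{1,\dots,d\}$ ($j$ is called a strategy). Parameters: $\lambda>0$ (rate of execution of decisions), $q^j_+$ (rate of transition $jI\to jS$), $q^j_-$ (rate of transition $jS\to jI$), $\beta_{jk}\ge0$ (rate at which an agent in $jI$ stimulates the transition of another agent from $kS$ to $kI$), $w^j_I,w^j_S$ (costs per unit time in states $jI,jS$, with $w^j_S<w^j_I$), $\delta>0$ (discounting coefficient). A distribution is a vector $x=(x_{jI},x_{jS})_{j=1}^d$ with nonnegative entries summing to $1$. A control $u$ assigns to each state a preferred strategy $u(jI),u(jS)\in\{1,\dots,d\}$ and may depend on time; it is stationary if it does not. The control $\hat u^i$ is $\hat u^i(jI)=\hat u^i(jS)=i$ for all $j$. $\mathbf 1(\cdot)$ denotes the indicator. Evolution of the distribution under a common control $u$, for all $j$: $$\dot x_{jI}=\lambda\sum_{k\ne j}x_{kI}\mathbf 1(u(kI)=j)-\lambda\sum_{k\ne j}x_{jI}\mathbf 1(u(jI)=k)+x_{jS}q^j_--x_{jI}q^j_++\sum_k x_{jS}x_{kI}\beta_{kj},$$ $$\dot x_{jS}=\lambda\sum_{k\ne j}x_{kS}\mathbf 1(u(kS)=j)-\lambda\sum_{k\ne j}x_{jS}\mathbf 1(u(jS)=k)-x_{jS}q^j_-+x_{jI}q^j_+-\sum_k x_{jS}x_{kI}\beta_{kj}.$$ Discounted HJB equation for $g=g_s$ (the discounted optimal payoff, i.e. minimal cost, of an individual player being $e^{-s\delta}g_s$) given $x(s)$, for all $j$: $$\dot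 g(jI)+\lambda\min_u\sum_{k=1}^d\mathbf 1(u(jI)=k)(g(kI)-g(jI))+q^j_+(g(jS)-g(jI))+w^j_I=\delta g(jI),$$ $$\dot g(jS)+\lambda\min_u\sum_{k=1}^d\mathbf 1(u(jS)=k)(g(kS)-g(jS))+\Big(q^j_-+\sum_{k}\beta_{kj}x_{kI}(s)\Big)(g(jI)-g(jS))+w^j_S=\delta g(jS).$$ A solution of the discounted MFG consistency equation on $[t,T]$ is a triple $(x,u,g)$ solving this coupled forward-backward system: $x$ solves the evolution forward from $x(t)$ under the common control $u$, $g$ solves the HJB equation backward from $g_T$ with this $x$, and the common control $u_s$ coincides with the minimizers in the HJB equation. The stationary solution $(\bar x,\bar g)$ associated with $\hat u^i$: $\bar x_{iI}=x^*$, $\bar x_{iS}=1-x^*$, $\bar x_{jI}=\bar x_{jS}=0$ for $j\ne i$, where $x^*$ is the unique root in $(0,1)$ of $\beta_{ii}y^2+y(q^i_+-\beta_{ii}+q^i_-)-q^i_-=0$ (this $\bar x$ is the fixed point of the evolution under $\hat u^i$); and $\bar g$ is the time-independent solution of the HJB equation with $x(s)\equiv\bar x$ in which the minimizing control is $\hat u^i$, i.e. with the minima replaced by $\lambda(g(iI)-g(jI))$ and $\lambda(g(iS)-g(jS))$ respectively. *)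

theory Defs
  imports Complex_Main
begin

text \<open>The strategies are the elements of a finite type, of cardinality $d$.\<close>

datatype status = Infected | Susceptible

instance status :: finite
proof
  have "(UNIV :: status set) = {Infected, Susceptible}"
    using status.exhaust by auto
  then show "finite (UNIV :: status set)"
    by (metis finite.emptyI finite.insertI)
qed

text \<open>The states $jI$ and $jS$ are \<^term>\<open>(j, Infected)\<close> and \<^term>\<open>(j, Susceptible)\<close>.\<close>

type_synonym 'd state = "'d \<times> status"
type_synonym 'd control = "'d state \<Rightarrow> 'd"

definition distribution :: "('d::finite state \<Rightarrow> real) \<Rightarrow> bool" where
  "distribution x \<longleftrightarrow> (\<forall>z. 0 \<le> x z) \<and> (\<Sum>z\<in>UNIV. x z) = 1"

definition u_hat :: "'d \<Rightarrow> 'd control" where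
  "u_hat i = (\<lambda>z. i)"

text \<open>Throughout, \<open>qp j\<close> is $q^j_+$, \<open>qm j\<close> is $q^j_-$ and \<open>w (j, m)\<close> is the cost in state \<open>(j, m)\<close>;
  \<open>\<beta> k j\<close> is the rate at which an agent in $kI$ stimulates the transition of another agent
  from $jS$ to $jI$.\<close>

fun evolution_rhs ::
  "real \<Rightarrow> ('d::finite \<Rightarrow> real) \<Rightarrow> ('d \<Rightarrow> real) \<Rightarrow> ('d \<Rightarrow> 'd \<Rightarrow> real) \<Rightarrow>
   'd control \<Rightarrow> ('d state \<Rightarrow> real) \<Rightarrow> 'd state \<Rightarrow> real" where
  "evolution_rhs lam qp qm \<beta> u x (j, Infected) =
      lam * (\<Sum>k\<in>UNIV - {j}. x (k, Infected) * of_bool (u (k, Infected) = j))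
    - lam * (\<Sum>k\<in>UNIV - {j}. x (j, Infected) * of_bool (u (j, Infected) = k))
    + x (j, Susceptible) * qm j - x (j, Infected) * qp j
    + (\<Sum>k\<in>UNIV. x (j, Susceptible) * x (k, Infected) * \<beta> k j)"
| "evolution_rhs lam qp qm \<beta> u x (j, Susceptible) =
      lam * (\<Sum>k\<in>UNIV - {j}. x (k, Susceptible) * of_bool (u (k, Susceptible) = j))
    - lam * (\<Sum>k\<in>UNIV - {j}. x (j, Susceptible) * of_bool (u (j, Susceptible) = k))
    - x (j, Susceptible) * qm j + x (j, Infected) * qp j
    - (\<Sum>k\<in>UNIV. x (j, Susceptible) * x (k, Infected) * \<beta> k j)"

fun switch_gain :: "'d::finite control \<Rightarrow> ('d state \<Rightarrow> real) \<Rightarrow> 'd state \<Rightarrow> real" where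
  "switch_gain u g (j, m) = (\<Sum>k\<in>UNIV. of_bool (u (j, m) = k) * (g (k, m) - g (j, m)))"

text \<open>The minimum over all controls; there are finitely many of them.\<close>

definition min_switch_gain :: "('d::finite state \<Rightarrow> real) \<Rightarrow> 'd state \<Rightarrow> real" where
  "min_switch_gain g z = Min (range (\<lambda>u. switch_gain u g z))"

text \<open>Minimizers need not be unique: a control is minimizing if it attains the minimum
  in every state.\<close>

definition minimizing :: "'d::finite control \<Rightarrow> ('d state \<Rightarrow> real) \<Rightarrow> bool" where
  "minimizing u g \<longleftrightarrow> (\<forall>z. switch_gain u g z = min_switch_gain g z)"

text \<open>The left-hand side of the HJB equation without the time derivative.\<close>

fun hjb_lhs ::
  "real \<Rightarrow> ('d::finite \<Rightarrow> real) \<Rightarrow> ('d \<Rightarrow> real) \<Rightarrow> ('d state \<Rightarrow> real) \<Rightarrow> ('d \<Rightarrow> 'd \<Rightarrow> real) \<Rightarrow>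
   ('d state \<Rightarrow> real) \<Rightarrow> ('d state \<Rightarrow> real) \<Rightarrow> 'd state \<Rightarrow> real" where
  "hjb_lhs lam qp qm w \<beta> x g (j, Infected) =
      lam * min_switch_gain g (j, Infected)
    + qp j * (g (j, Susceptible) - g (j, Infected)) + w (j, Infected)"
| "hjb_lhs lam qp qm w \<beta> x g (j, Susceptible) =
      lam * min_switch_gain g (j, Susceptible)
    + (qm j + (\<Sum>k\<in>UNIV. \<beta> k j * x (k, Infected))) * (g (j, Infected) - g (j, Susceptible))
    + w (j, Susceptible)"

text \<open>\<open>x\<close>, \<open>u\<close>, \<open>g\<close> take a time as first argument; their values outside \<open>{t..T}\<close> are irrelevant.
  Derivatives at the endpoints are one-sided.\<close>

definition mfg_solution ::
  "real \<Rightarrow> ('d::finite \<Rightarrow> real) \<Rightarrow> ('d \<Rightarrow> real) \<Rightarrow> ('d state \<Rightarrow> real) \<Rightarrow> real \<Rightarrow> ('d \<Rightarrow> 'd \<Rightarrow> real) \<Rightarrow>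
   real \<Rightarrow> real \<Rightarrow> ('d state \<Rightarrow> real) \<Rightarrow> ('d state \<Rightarrow> real) \<Rightarrow>
   (real \<Rightarrow> 'd state \<Rightarrow> real) \<Rightarrow> (real \<Rightarrow> 'd control) \<Rightarrow> (real \<Rightarrow> 'd state \<Rightarrow> real) \<Rightarrow> bool" where
  "mfg_solution lam qp qm w \<delta> \<beta> t T x0 gT x u g \<longleftrightarrow>
     x t = x0 \<and> g T = gT \<and>
     (\<forall>s\<in>{t..T}.
        distribution (x s) \<and>
        (\<forall>z. ((\<lambda>r. x r z) has_real_derivative evolution_rhs lam qp qm \<beta> (u s) (x s) z)
               (at s within {t..T})) \<and>
        (\<forall>z. \<exists>g'. ((\<lambda>r. g r z) has_real_derivative g') (at s within {t..T}) \<and>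
               g' + hjb_lhs lam qp qm w \<beta> (x s) (g s) z = \<delta> * g s z) \<and>
        minimizing (u s) (g s))"

definition x_star :: "('d \<Rightarrow> real) \<Rightarrow> ('d \<Rightarrow> real) \<Rightarrow> ('d \<Rightarrow> 'd \<Rightarrow> real) \<Rightarrow> 'd \<Rightarrow> real" where
  "x_star qp qm \<beta> i =
     (THE y. 0 < y \<and> y < 1 \<and> \<beta> i i * y\<^sup>2 + y * (qp i - \<beta> i i + qm i) - qm i = 0)"

definition x_bar ::
  "('d \<Rightarrow> real) \<Rightarrow> ('d \<Rightarrow> real) \<Rightarrow> ('d \<Rightarrow> 'd \<Rightarrow> real) \<Rightarrow> 'd \<Rightarrow> 'd state \<Rightarrow> real" where
  "x_bar qp qm \<beta> i =
     (\<lambda>(j, m). if j \<noteq> i then 0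
               else case m of Infected \<Rightarrow> x_star qp qm \<beta> i | Susceptible \<Rightarrow> 1 - x_star qp qm \<beta> i)"

text \<open>As \<^term>\<open>u_hat i\<close> is minimizing, the minima in the equation for the stationary payoff are
  \<open>g (i, m) - g (j, m)\<close>.\<close>

definition g_bar ::
  "real \<Rightarrow> ('d::finite \<Rightarrow> real) \<Rightarrow> ('d \<Rightarrow> real) \<Rightarrow> ('d state \<Rightarrow> real) \<Rightarrow> real \<Rightarrow> ('d \<Rightarrow> 'd \<Rightarrow> real) \<Rightarrow>
   'd \<Rightarrow> 'd state \<Rightarrow> real" where
  "g_bar lam qp qm w \<delta> \<beta> i =
     (THE g. (\<forall>z. hjb_lhs lam qp qm w \<beta> (x_bar qp qm \<beta> i) g z = \<delta> * g z) \<and>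
             minimizing (u_hat i) g)"

definition admissible_terminal :: "'d \<Rightarrow> real \<Rightarrow> ('d state \<Rightarrow> real) \<Rightarrow> bool" where
  "admissible_terminal i \<eta> gT \<longleftrightarrow>
     (\<forall>j. gT (j, Infected) - gT (j, Susceptible) \<ge> 0) \<and>
     gT (i, Infected) - gT (i, Susceptible) \<le> \<eta> \<and>
     (\<forall>j. j \<noteq> i \<longrightarrow> gT (i, Infected) \<le> gT (j, Infected) \<and>
                    gT (i, Susceptible) \<le> gT (j, Susceptible))"

end

theory Submission
  imports Defs "HOL-Analysis.Analysis" "HOL-Real_Asymp.Real_Asymp"
begin

text \<open>
  Once every agent uses the control \<^term>\<open>u_hat i\<close>, the forward equation no longer involves the
  payoff, so the coupled system decouples: first the distribution is found, then the payoff, which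
  solves a linear backward equation whose only time-dependent coefficient is the infection pressure
  \<open>b\<^sub>j = (\<Sum>k. \<beta> k j * x (k, Infected))\<close>. What has to be shown is that the payoff so obtained makes
  \<^term>\<open>u_hat i\<close> minimizing, that is \<open>g (i, m) \<le> g (j, m)\<close> at all times.

  The gap \<open>\<Delta> = g (i, Infected) - g (i, Susceptible)\<close> solves a scalar equation with decay rate at
  least \<open>qm i + qp i + \<delta>\<close> (backward in time) and constant source \<open>w (i, Infected) - w (i, Susceptible)\<close>.
  Hence \<open>\<Delta>\<close> stays between \<open>0\<close> and the quotient \<open>\<Delta>*\<close> of these two numbers if its terminal value does,
  and \<open>\<Delta>*\<close> can serve as the bound \<open>\<eta>\<close> of the theorem. The two advantages \<open>g (j, m) - g (i, m)\<close> solve a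
  cooperative backward system with the sources
  \<open>w (j, Infected) - w (i, Infected) - (qp j - qp i) * \<Delta>\<close> and
  \<open>w (j, Susceptible) - w (i, Susceptible) - (qm i - qm j + b\<^sub>i - b\<^sub>j) * \<Delta>\<close>. As \<open>qp i < qp j\<close> and
  \<open>qm j < qm i\<close>, they are smallest at \<open>\<Delta> = \<Delta>*\<close> (up to the pressures), and there the two cost inequalities
  of the theorem say that they are positive when \<open>\<beta> = 0\<close>; strictness leaves room for a small \<open>\<beta>\<close>.
  A cooperative system with nonnegative sources preserves nonnegativity: lemmas
  \<open>backward_positivity\<close>, \<open>payoff_slope_advantage\<close> and \<open>payoff_order\<close>.

  Existence of the distribution is a Picard argument inside the simplex
  (\<open>relaxation_ode_solution_in_convex\<close>); existence of the payoff follows by integrating scalar linear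
  equations one after the other (\<open>payoff_path_exists\<close>).

  For the long-time behaviour, the mass outside strategy \<open>i\<close> decays like \<open>exp (- lam * (s - t))\<close>, and
  what remains is a scalar equation for \<open>x (i, Infected)\<close> which contracts to its root \<open>x*\<close> as long as
  \<open>\<beta> i i < qp i + qm i\<close> (\<open>population_converges\<close>). The difference of the payoff and the stationary
  payoff solves the equation of a discounted Markov chain, so by a maximum principle it is at most its
  terminal size times \<open>exp (- \<delta> * (T - s))\<close> plus an error that is proportional to the distance of the
  pressures (\<open>payoff_difference\<close>, \<open>payoff_turnpike\<close>).
\<close>

section \<open>Differential inequalities and linear equations\<close>

lemma le_of_nonneg_derivative:
  fixes f f' :: "real \<Rightarrow> real"
  assumes "\<And>s. s \<in> {t..T} \<Longrightarrow> (f has_real_derivative f' s) (at s within {t..T})"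
    and "\<And>s. s \<in> {t..T} \<Longrightarrow> 0 \<le> f' s"
    and "t \<le> a" "a \<le> b" "b \<le> T"
  shows "f a \<le> f b"
proof (rule DERIV_nonneg_imp_increasing_open[OF \<open>a \<le> b\<close>])
  show "continuous_on {a..b} f"
    by (rule continuous_on_subset[OF DERIV_continuous_on[OF assms(1)]]) (use assms(3-5) in auto)
next
  fix s assume s: "a < s" "s < b"
  then have "at s within {t..T} = at s"
    using assms(3,5) by (intro at_within_interior) auto
  then show "\<exists>y. DERIV f s :> y \<and> 0 \<le> y"
    using assms(1)[of s] assms(2)[of s] s assms(3,5) by auto
qed

text \<open>
  The forcing decays at the same rate as the homogeneous equation; the resonance costs the factor
  \<open>C * (s - t)\<close>. Multiplying \<open>v\<close> by \<open>exp (\<mu> * (s - t))\<close> turns the inequality into a bound \<open>C\<close> on a slope.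
  With \<open>C = 0\<close> and negative \<open>\<mu>\<close> this is Gronwall's inequality.
\<close>

lemma gronwall_exponential:
  fixes v v' :: "real \<Rightarrow> real"
  assumes der: "\<And>s. s \<in> {t..T} \<Longrightarrow> (v has_real_derivative v' s) (at s within {t..T})"
    and le: "\<And>s. s \<in> {t..T} \<Longrightarrow> v' s \<le> - (\<mu> * v s) + C * exp (- \<mu> * (s - t))"
    and s: "s \<in> {t..T}"
  shows "v s \<le> (v t + C * (s - t)) * exp (- \<mu> * (s - t))"
proof -
  have "- (v t * exp (\<mu> * (t - t))) + C * (t - t) \<le> - (v s * exp (\<mu> * (s - t))) + C * (s - t)"
  proof (rule le_of_nonneg_derivative[where f = "\<lambda>r. - (v r * exp (\<mu> * (r - t))) + C * (r - t)"
        and f' = "\<lambda>r. - (v' r * exp (\<mu> * (r - t)) + v r * (exp (\<mu> * (r - t)) * \<mu>)) + C"])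
    fix r assume r: "r \<in> {t..T}"
    show "((\<lambda>r. - (v r * exp (\<mu> * (r - t))) + C * (r - t)) has_real_derivative
        - (v' r * exp (\<mu> * (r - t)) + v r * (exp (\<mu> * (r - t)) * \<mu>)) + C) (at r within {t..T})"
      by (rule derivative_eq_intros der[OF r] refl | simp)+
    have "v' r * exp (\<mu> * (r - t)) \<le> (- (\<mu> * v r) + C * exp (- \<mu> * (r - t))) * exp (\<mu> * (r - t))"
      using le[OF r] by (intro mult_right_mono) auto
    also have "\<dots> = - (\<mu> * v r) * exp (\<mu> * (r - t)) + C"
      by (simp add: algebra_simps flip: exp_add)
    finally show "0 \<le> - (v' r * exp (\<mu> * (r - t)) + v r * (exp (\<mu> * (r - t)) * \<mu>)) + C"
      by (simp add: algebra_simps)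
  qed (use s in auto)
  then have "v s * exp (\<mu> * (s - t)) \<le> v t + C * (s - t)"
    by simp
  then have "v s * exp (\<mu> * (s - t)) * exp (- \<mu> * (s - t)) \<le> (v t + C * (s - t)) * exp (- \<mu> * (s - t))"
    by (rule mult_right_mono) simp
  then show ?thesis
    by (simp add: mult.assoc flip: exp_add)
qed

text \<open>
  The squared negative part is a continuously differentiable measure of the violation of \<open>0 \<le> y\<close>.
\<close>

lemma has_real_derivative_negative_part_square:
  "((\<lambda>y::real. (min y 0)\<^sup>2) has_real_derivative 2 * min y 0) (at y)"
proof -
  consider "y < 0" | "y = 0" | "y > 0" by linarith
  then show ?thesis
  proof cases
    case 1
    have "((\<lambda>y::real. y\<^sup>2) has_real_derivative 2 * min y 0) (at y)"
      using 1 by (auto intro!: derivative_eq_intros)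
    then show ?thesis
      by (rule has_field_derivative_transform_within_open[where S = "{..<0}"]) (use 1 in auto)
  next
    case 2
    have "((\<lambda>h::real. (min h 0)\<^sup>2 / h) \<longlongrightarrow> 0) (at 0)"
    proof (rule Lim_null_comparison)
      show "\<forall>\<^sub>F h in at 0. norm ((min h 0)\<^sup>2 / h) \<le> \<bar>h\<bar>" for h :: real
        by (rule always_eventually) (auto simp: min_def power2_eq_square)
      show "((\<lambda>h::real. \<bar>h\<bar>) \<longlongrightarrow> 0) (at 0)"
        by (rule tendsto_eq_intros refl | simp)+
    qed
    then show ?thesis
      using 2 by (simp add: DERIV_def)
  next
    case 3
    have "((\<lambda>y::real. 0) has_real_derivative 2 * min y 0) (at y)"
      using 3 by (auto intro!: derivative_eq_intros)
    then show ?thesis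
      by (rule has_field_derivative_transform_within_open[where S = "{0<..}"]) (use 3 in auto)
  qed
qed

text \<open>
  Seen backward from \<open>T\<close>, \<open>u\<close> grows at least like a cooperative linear system (\<open>Q\<close> is nonnegative), and
  such systems cannot leave the nonnegative orthant. The total squared negative part \<open>\<phi>\<close> measures by how
  much it is left: a negative component is pushed down only by other negative components, so
  \<open>- \<phi>' \<le> \<kappa> * \<phi>\<close>, and \<open>\<phi> T = 0\<close> forces \<open>\<phi> = 0\<close>.
\<close>

lemma backward_positivity:
  fixes u u' c :: "real \<Rightarrow> 'z::finite \<Rightarrow> real" and Q :: "real \<Rightarrow> 'z \<Rightarrow> 'z \<Rightarrow> real"
  assumes der: "\<And>s z. s \<in> {t..T} \<Longrightarrow> ((\<lambda>r. u r z) has_real_derivative u' s z) (at s within {t..T})"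
    and le: "\<And>s z. s \<in> {t..T} \<Longrightarrow> u' s z \<le> c s z * u s z - (\<Sum>z'\<in>UNIV. Q s z z' * u s z')"
    and Q: "\<And>s z z'. s \<in> {t..T} \<Longrightarrow> 0 \<le> Q s z z' \<and> Q s z z' \<le> K"
    and c: "\<And>s z. s \<in> {t..T} \<Longrightarrow> \<bar>c s z\<bar> \<le> K"
    and final: "\<And>z. 0 \<le> u T z"
    and s: "s \<in> {t..T}"
  shows "0 \<le> u s z"
proof -
  define n where "n = (\<lambda>s z. min (u s z) 0)"
  define \<phi> where "\<phi> = (\<lambda>s. \<Sum>z\<in>UNIV. (n s z)\<^sup>2)"
  define \<kappa> where "\<kappa> = 2 * K + 2 * (real CARD('z) * K)"
  have K: "0 \<le> K"
    using Q[OF s] order_trans by blast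
  have d\<phi>: "(\<phi> has_real_derivative (\<Sum>z\<in>UNIV. 2 * n r z * u' r z)) (at r within {t..T})"
    if r: "r \<in> {t..T}" for r
    unfolding \<phi>_def n_def
    by (rule DERIV_sum DERIV_chain2[OF has_real_derivative_negative_part_square] der r)+
  have single: "2 * n r z * u' r z \<ge> - (2 * K) * (n r z)\<^sup>2 - (\<Sum>z'\<in>UNIV. K * ((n r z)\<^sup>2 + (n r z')\<^sup>2))"
    if r: "r \<in> {t..T}" for r z
  proof -
    have n0: "n r z \<le> 0" for z
      by (simp add: n_def)
    have "n r z * (c r z * u r z - (\<Sum>z'\<in>UNIV. Q r z z' * u r z')) \<le> n r z * u' r z"
      using le[OF r] n0 by (rule mult_left_mono_neg)
    moreover have "n r z * u r z = (n r z)\<^sup>2"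
      by (simp add: n_def min_def power2_eq_square)
    then have "n r z * (c r z * u r z) = c r z * (n r z)\<^sup>2"
      by (metis mult.left_commute)
    moreover have "- K * (n r z)\<^sup>2 \<le> c r z * (n r z)\<^sup>2"
      using c[OF r, of z] by (intro mult_right_mono) auto
    moreover have "2 * (n r z * (\<Sum>z'\<in>UNIV. Q r z z' * u r z')) \<le> (\<Sum>z'\<in>UNIV. K * ((n r z)\<^sup>2 + (n r z')\<^sup>2))"
      unfolding sum_distrib_left
    proof (rule sum_mono)
      fix z'
      have "n r z * u r z' \<le> n r z * n r z'"
        using n0 by (intro mult_left_mono_neg) (auto simp: n_def)
      moreover have "2 * (n r z * n r z') \<le> (n r z)\<^sup>2 + (n r z')\<^sup>2"
        using sum_squares_bound[of "n r z" "n r z'"] by simp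
      ultimately have "2 * (n r z * u r z') \<le> (n r z)\<^sup>2 + (n r z')\<^sup>2"
        by linarith
      then have "Q r z z' * (2 * (n r z * u r z')) \<le> Q r z z' * ((n r z)\<^sup>2 + (n r z')\<^sup>2)"
        using Q[OF r] by (intro mult_left_mono) auto
      also have "\<dots> \<le> K * ((n r z)\<^sup>2 + (n r z')\<^sup>2)"
        using Q[OF r] by (intro mult_right_mono) auto
      finally show "2 * (n r z * (Q r z z' * u r z')) \<le> K * ((n r z)\<^sup>2 + (n r z')\<^sup>2)"
        by (simp add: ac_simps)
    qed
    ultimately show ?thesis
      by (simp add: right_diff_distrib)
  qed
  have "- (\<kappa> * \<phi> r) \<le> (\<Sum>z\<in>UNIV. 2 * n r z * u' r z)" if r: "r \<in> {t..T}" for r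
  proof -
    have "(\<Sum>z\<in>UNIV. - (2 * K) * (n r z)\<^sup>2 - (\<Sum>z'\<in>UNIV. K * ((n r z)\<^sup>2 + (n r z')\<^sup>2)))
        \<le> (\<Sum>z\<in>UNIV. 2 * n r z * u' r z)"
      by (rule sum_mono) (use single[OF r] in blast)
    moreover have "(\<Sum>z\<in>UNIV. - (2 * K) * (n r z)\<^sup>2 - (\<Sum>z'\<in>UNIV. K * ((n r z)\<^sup>2 + (n r z')\<^sup>2))) = - (\<kappa> * \<phi> r)"
      by (simp add: \<kappa>_def \<phi>_def sum_subtractf sum.distrib sum_negf algebra_simps
          flip: sum_distrib_left)
    ultimately show ?thesis by simp
  qed
  then have nonneg: "0 \<le> (\<Sum>z\<in>UNIV. 2 * n r z * u' r z) * exp (\<kappa> * r) + \<phi> r * (exp (\<kappa> * r) * \<kappa>)"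
    if r: "r \<in> {t..T}" for r
  proof -
    have "0 \<le> ((\<Sum>z\<in>UNIV. 2 * n r z * u' r z) + \<kappa> * \<phi> r) * exp (\<kappa> * r)"
      using \<open>\<And>r. r \<in> {t..T} \<Longrightarrow> - (\<kappa> * \<phi> r) \<le> _\<close>[OF r] by (intro mult_nonneg_nonneg) auto
    then show ?thesis by (simp add: algebra_simps)
  qed
  have "\<phi> s * exp (\<kappa> * s) \<le> \<phi> T * exp (\<kappa> * T)"
  proof (rule le_of_nonneg_derivative[where f = "\<lambda>r. \<phi> r * exp (\<kappa> * r)"
        and f' = "\<lambda>r. (\<Sum>z\<in>UNIV. 2 * n r z * u' r z) * exp (\<kappa> * r) + \<phi> r * (exp (\<kappa> * r) * \<kappa>)", OF _ nonneg])
    fix r assume r: "r \<in> {t..T}"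
    show "((\<lambda>r. \<phi> r * exp (\<kappa> * r)) has_real_derivative
        (\<Sum>z\<in>UNIV. 2 * n r z * u' r z) * exp (\<kappa> * r) + \<phi> r * (exp (\<kappa> * r) * \<kappa>)) (at r within {t..T})"
      by (rule derivative_eq_intros d\<phi>[OF r] refl | simp)+
  qed (use s in auto)
  moreover have "\<phi> T = 0"
    using final by (simp add: \<phi>_def n_def min_absorb2)
  ultimately have "\<phi> s \<le> 0"
    by (simp add: mult_le_0_iff)
  moreover have "0 \<le> \<phi> s"
    unfolding \<phi>_def by (intro sum_nonneg) auto
  ultimately have "\<phi> s = 0" by simp
  then have "n s z = 0"
    unfolding \<phi>_def by (subst (asm) sum_nonneg_eq_0_iff) auto
  then show ?thesis
    by (simp add: n_def min_def split: if_splits)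
qed

text \<open>
  If \<open>Q\<close> is the rate matrix of a Markov chain, \<open>e\<close> is a discounted expected payoff with running payoff
  between \<open>- \<rho>\<close> and \<open>\<rho>\<close> and terminal payoff between \<open>- V\<close> and \<open>V\<close>. The right-hand side \<open>\<phi>\<close> is the
  value obtained from the constant running payoff \<open>\<rho>\<close> and the terminal payoff \<open>V + \<rho> / \<delta>\<close>; being
  constant over states it is not affected by \<open>Q\<close>, and both \<open>\<phi> - e\<close> and \<open>\<phi> + e\<close> satisfy a cooperative inequality.
\<close>

lemma discounted_maximum_principle:
  fixes e e' :: "real \<Rightarrow> 'z::finite \<Rightarrow> real" and Q :: "real \<Rightarrow> 'z \<Rightarrow> 'z \<Rightarrow> real"
  assumes \<delta>: "0 < \<delta>"
    and der: "\<And>s z. s \<in> {p..T} \<Longrightarrow> ((\<lambda>r. e r z) has_real_derivative e' s z) (at s within {p..T})"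
    and eq: "\<And>s z. s \<in> {p..T} \<Longrightarrow>
      \<bar>e' s z - (\<delta> * e s z - (\<Sum>z'\<in>UNIV. Q s z z' * (e s z' - e s z)))\<bar> \<le> \<rho>"
    and Q: "\<And>s z z'. s \<in> {p..T} \<Longrightarrow> 0 \<le> Q s z z' \<and> Q s z z' \<le> K"
    and final: "\<And>z. \<bar>e T z\<bar> \<le> V"
    and s: "s \<in> {p..T}"
  shows "\<bar>e s z\<bar> \<le> V * exp (- \<delta> * (T - s)) + \<rho> / \<delta>"
proof -
  define \<phi> where "\<phi> = (\<lambda>s. V * exp (- \<delta> * (T - s)) + \<rho> / \<delta>)"
  define c where "c = (\<lambda>s z. \<delta> + (\<Sum>z'\<in>UNIV. Q s z z'))"
  define K' where "K' = \<delta> + real CARD('z) * K"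
  have d\<phi>: "(\<phi> has_real_derivative (\<delta> * \<phi> r - \<rho>)) (at r within {p..T})" for r
  proof -
    have "(\<phi> has_real_derivative V * (exp (- \<delta> * (T - r)) * \<delta>)) (at r within {p..T})"
      unfolding \<phi>_def by (rule derivative_eq_intros refl | simp)+
    moreover have "\<delta> * \<phi> r - \<rho> = V * (exp (- \<delta> * (T - r)) * \<delta>)"
      using \<delta> by (simp add: \<phi>_def algebra_simps)
    ultimately show ?thesis by simp
  qed
  have K: "0 \<le> K"
    using Q[OF s] order_trans by blast
  have "0 \<le> \<rho>" using eq[OF s] abs_ge_zero order_trans by blast
  have *: "0 \<le> \<phi> s - \<sigma> * e s z" if \<sigma>: "\<sigma> = 1 \<or> \<sigma> = -1" for \<sigma>
  proof (rule backward_positivity[where u = "\<lambda>r z. \<phi> r - \<sigma> * e r z" and c = c and Q = Q and K = K'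
      and u' = "\<lambda>r z. \<delta> * \<phi> r - \<rho> - \<sigma> * e' r z", OF _ _ _ _ _ s])
    fix r z assume r: "r \<in> {p..T}"
    show "((\<lambda>r. \<phi> r - \<sigma> * e r z) has_real_derivative \<delta> * \<phi> r - \<rho> - \<sigma> * e' r z) (at r within {p..T})"
      by (rule derivative_eq_intros d\<phi> der[OF r] refl | simp)+
    have "c r z * (\<phi> r - \<sigma> * e r z) - (\<Sum>z'\<in>UNIV. Q r z z' * (\<phi> r - \<sigma> * e r z'))
       = \<delta> * (\<phi> r - \<sigma> * e r z) + \<sigma> * (\<Sum>z'\<in>UNIV. Q r z z' * (e r z' - e r z))"
      by (simp add: c_def algebra_simps sum_subtractf sum_distrib_left sum_distrib_right)
    moreover have "\<delta> * \<phi> r - \<rho> - \<sigma> * e' r z \<le> \<dots>"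
      using eq[OF r, of z] \<sigma> by (auto simp: algebra_simps)
    ultimately show "\<delta> * \<phi> r - \<rho> - \<sigma> * e' r z \<le>
        c r z * (\<phi> r - \<sigma> * e r z) - (\<Sum>z'\<in>UNIV. Q r z z' * (\<phi> r - \<sigma> * e r z'))"
      by simp
    have "(\<Sum>z'\<in>UNIV. Q r z z') \<le> real CARD('z) * K" "0 \<le> (\<Sum>z'\<in>UNIV. Q r z z')"
      using Q[OF r] by (auto intro!: sum_bounded_above sum_nonneg)
    then show "\<bar>c r z\<bar> \<le> K'"
      using \<delta> by (simp add: c_def K'_def)
    have "K \<le> real CARD('z) * K"
      using K mult_right_mono[of 1 "real CARD('z)" K]
      by (simp add: Suc_leI)
    then show "0 \<le> Q r z z' \<and> Q r z z' \<le> K'" for z'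
      using Q[OF r, of z z'] \<delta> unfolding K'_def by linarith
  next
    show "0 \<le> \<phi> T - \<sigma> * e T z" for z
    proof -
      have "0 \<le> \<rho> / \<delta>" using \<delta> \<open>0 \<le> \<rho>\<close> by simp
      moreover have "\<sigma> * e T z \<le> V" using final[of z] \<sigma> by auto
      ultimately show ?thesis by (simp add: \<phi>_def)
    qed
  qed
  from *[of 1] *[of "-1"] show ?thesis
    by (auto simp: \<phi>_def)
qed

lemma scalar_linear_ode_backward:
  fixes a r :: "real \<Rightarrow> real"
  assumes a: "continuous_on {t..T} a" and r: "continuous_on {t..T} r"
  shows "\<exists>y. y T = yT \<and>
    (\<forall>s\<in>{t..T}. (y has_real_derivative a s * y s + r s) (at s within {t..T}))"
proof -
  obtain A where A: "\<And>s. s \<in> {t..T} \<Longrightarrow> (A has_real_derivative a s) (at s within {t..T})"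
    using antiderivative_continuous[OF a] by (auto simp: has_real_derivative_iff_has_vector_derivative)
  have "continuous_on {t..T} A"
    using A by (rule DERIV_continuous_on)
  then have rA: "continuous_on {t..T} (\<lambda>s. r s * exp (- A s))"
    using r by (intro continuous_intros)
  obtain B where B: "\<And>s. s \<in> {t..T} \<Longrightarrow> (B has_real_derivative r s * exp (- A s)) (at s within {t..T})"
    using antiderivative_continuous[OF rA] by (auto simp: has_real_derivative_iff_has_vector_derivative)
  define y where "y = (\<lambda>s. exp (A s) * (B s - B T + yT * exp (- A T)))"
  have "(y has_real_derivative a s * y s + r s) (at s within {t..T})" if s: "s \<in> {t..T}" for s
    unfolding y_def
    by (rule derivative_eq_intros A[OF s] B[OF s] refl | simp)+ (simp add: algebra_simps flip: exp_add)
  moreover have "y T = yT"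
    by (simp add: y_def algebra_simps flip: exp_add)
  ultimately show ?thesis by blast
qed

text \<open>
  Every component is coupled to component \<open>i\<close> only, and component \<open>i\<close> is coupled to nothing; so
  component \<open>i\<close> is found first and enters the equations of the others as a known source.
\<close>

lemma star_coupled_linear_ode_backward:
  fixes a r :: "real \<Rightarrow> 'd \<Rightarrow> real"
  assumes a: "\<And>j. continuous_on {t..T} (\<lambda>s. a s j)" and r: "\<And>j. continuous_on {t..T} (\<lambda>s. r s j)"
  shows "\<exists>y. (\<forall>j. y T j = yT j) \<and>
    (\<forall>s\<in>{t..T}. \<forall>j. ((\<lambda>s. y s j) has_real_derivative
        a s j * y s j - l * (y s i - y s j) + r s j) (at s within {t..T}))"
proof -
  obtain yi where yi: "yi T = yT i"
    "\<And>s. s \<in> {t..T} \<Longrightarrow> (yi has_real_derivative a s i * yi s + r s i) (at s within {t..T})"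
    using scalar_linear_ode_backward[OF a[of i] r[of i]] by blast
  have yi_cont: "continuous_on {t..T} yi"
    using yi(2) by (rule DERIV_continuous_on)
  have "\<exists>y. y T = yT j \<and> (\<forall>s\<in>{t..T}. (y has_real_derivative (a s j + l) * y s + (r s j - l * yi s))
      (at s within {t..T}))" for j
    by (rule scalar_linear_ode_backward) (intro continuous_intros a r yi_cont)+
  then obtain Y where Y: "\<And>j. Y j T = yT j" "\<And>j s. s \<in> {t..T} \<Longrightarrow>
      (Y j has_real_derivative (a s j + l) * Y j s + (r s j - l * yi s)) (at s within {t..T})"
    by metis
  define y where "y = (\<lambda>s j. if j = i then yi s else Y j s)"
  have "((\<lambda>s. y s j) has_real_derivative a s j * y s j - l * (y s i - y s j) + r s j) (at s within {t..T})"
    if "s \<in> {t..T}" for s j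
    using yi(2)[OF that] Y(2)[OF that, of j] by (simp add: y_def algebra_simps)
  moreover have "y T j = yT j" for j
    using yi(1) Y(1) by (simp add: y_def)
  ultimately show ?thesis by blast
qed

section \<open>Global solutions in a compact convex set\<close>

lemma integral_exp_real:
  fixes a :: real
  assumes "0 \<le> s" "a \<noteq> 0"
  shows "((\<lambda>r. exp (a * r)) has_integral (exp (a * s) - 1) / a) {0..s}"
proof -
  have "((\<lambda>r. exp (a * r)) has_integral exp (a * s) / a - exp (a * 0) / a) {0..s}"
    by (rule fundamental_theorem_of_calculus[OF assms(1)])
      (use assms(2) in \<open>auto intro!: derivative_eq_intros simp flip: has_real_derivative_iff_has_vector_derivative\<close>)
  then show ?thesis
    by (simp add: diff_divide_distrib)
qed

text \<open>
  The vector is a weighted average of \<open>x0\<close> and the values of \<open>f\<close>: the weights \<open>exp (- s)\<close> and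
  \<open>exp (r - s)\<close> have total mass 1. A closed convex set contains such averages, because a hyperplane
  separating the average from the set would also separate it from everything averaged.
\<close>

lemma exponential_average_mem_convex:
  fixes S :: "'a::euclidean_space set"
  assumes "closed S" "convex S" "x0 \<in> S" "0 \<le> s"
    and f: "continuous_on {0..s} f" "\<And>r. r \<in> {0..s} \<Longrightarrow> f r \<in> S"
  shows "exp (- s) *\<^sub>R (x0 + integral {0..s} (\<lambda>r. exp r *\<^sub>R f r)) \<in> S"
proof (rule ccontr)
  define y where "y = exp (- s) *\<^sub>R (x0 + integral {0..s} (\<lambda>r. exp r *\<^sub>R f r))"
  assume "\<not> ?thesis"
  then obtain a b where ab: "a \<bullet> y < b" "\<And>x. x \<in> S \<Longrightarrow> b < a \<bullet> x"
    using separating_hyperplane_closed_point[OF assms(2,1)] unfolding y_def by blast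
  have int: "(\<lambda>r. exp r *\<^sub>R f r) integrable_on {0..s}"
    by (intro integrable_continuous_real continuous_intros f)
  have "b * (exp s - 1) = integral {0..s} (\<lambda>r. exp r * b)"
    by (rule integral_unique[symmetric])
      (use has_integral_mult_left[OF integral_exp_real[OF \<open>0 \<le> s\<close>, of 1], of b] in \<open>simp add: mult.commute\<close>)
  also have "\<dots> \<le> integral {0..s} (\<lambda>r. a \<bullet> (exp r *\<^sub>R f r))"
  proof (rule integral_le)
    fix r assume "r \<in> {0..s}"
    then show "exp r * b \<le> a \<bullet> (exp r *\<^sub>R f r)"
      using ab(2)[OF f(2), of r] by simp
  qed (intro integrable_continuous_real continuous_intros f)+
  also have "\<dots> = a \<bullet> integral {0..s} (\<lambda>r. exp r *\<^sub>R f r)"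
    using integral_linear[OF int bounded_linear_inner_right[of a]] by (simp add: o_def)
  finally have "b * (exp s - 1) \<le> a \<bullet> integral {0..s} (\<lambda>r. exp r *\<^sub>R f r)" .
  moreover have "b < a \<bullet> x0"
    using ab(2) assms(3) by blast
  ultimately have "b * exp s \<le> a \<bullet> (x0 + integral {0..s} (\<lambda>r. exp r *\<^sub>R f r))"
    by (simp add: algebra_simps)
  also have "\<dots> = exp s * (a \<bullet> y)"
    by (simp add: y_def flip: exp_add mult.assoc)
  finally show False
    using ab(1) by (simp add: mult.commute)
qed

text \<open>
  Solutions of \<open>x' = F x - x\<close> are the fixed points of the variation-of-constants operator \<open>P\<close>. Each value
  of \<open>P x\<close> is an average of points of \<open>S\<close>, so \<open>P\<close> preserves paths in \<open>S\<close> and invariance of \<open>S\<close>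
  comes with existence. To make \<open>P\<close> a contraction on the whole half-line at once, paths are
  multiplied by \<open>exp (- \<kappa> * s)\<close>: a Lipschitz constant \<open>L\<close> of \<open>F\<close> then turns into \<open>L / \<kappa>\<close>. The bounded
  continuous functions live on the whole line; \<open>max 0 s\<close> extends them to negative times.
\<close>

lemma relaxation_ode_solution_in_convex:
  fixes F :: "'a::euclidean_space \<Rightarrow> 'a"
  assumes S: "compact S" "convex S" and F: "F ` S \<subseteq> S" and lip: "L-lipschitz_on S F" and x0: "x0 \<in> S"
  shows "\<exists>x. x 0 = x0 \<and> (\<forall>s\<ge>0. x s \<in> S) \<and>
    (\<forall>s\<ge>0. (x has_vector_derivative F (x s) - x s) (at s within {0..}))"
proof -
  have L: "0 \<le> L"
    using lip by (rule lipschitz_on_nonneg)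
  have Fcont: "continuous_on S F"
    using lip by (rule lipschitz_on_continuous_on)
  have "closed S" using S(1) by (rule compact_imp_closed)
  \<comment> \<open>Any positive number above \<open>L\<close> gives a contraction; this one also serves \<open>L = 0\<close>.\<close>
  define \<kappa> where "\<kappa> = 2 * L + 1"
  define P where "P = (\<lambda>x (s::real). exp (- s) *\<^sub>R (x0 + integral {0..s} (\<lambda>r. exp r *\<^sub>R F (x r))))"
  define unweight where "unweight = (\<lambda>(v::real \<Rightarrow>\<^sub>C 'a) r. exp (\<kappa> * r) *\<^sub>R apply_bcontfun v r)"
  define q where "q = (\<lambda>v s. exp (- \<kappa> * max 0 s) *\<^sub>R P (unweight v) (max 0 s))"
  define V where "V = {v. \<forall>r\<ge>0. unweight v r \<in> S}"
  have \<kappa>: "0 < \<kappa>" using L by (simp add: \<kappa>_def)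
  have unweight_cont: "continuous_on A (unweight v)" for A v
    unfolding unweight_def by (intro continuous_intros) auto
  have F_cont: "continuous_on {0..s} (\<lambda>r. F (unweight v r))" if "v \<in> V" for v s
    by (rule continuous_on_compose2[OF Fcont unweight_cont]) (use that in \<open>auto simp: V_def\<close>)
  have integrand_cont: "continuous_on {0..s} (\<lambda>r. exp r *\<^sub>R F (unweight v r))" if "v \<in> V" for v s
    by (intro continuous_intros F_cont that)
  have PS: "P (unweight v) s \<in> S" if "v \<in> V" "0 \<le> s" for v s
    unfolding P_def using that F
    by (intro exponential_average_mem_convex \<open>closed S\<close> S(2) x0 F_cont) (auto simp: V_def)
  have dP: "(P (unweight v) has_vector_derivative F (unweight v s) - P (unweight v) s) (at s within {0..})"
    if v: "v \<in> V" and s: "0 \<le> s" for v s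
  proof -
    \<comment> \<open>Integrals are differentiated on bounded intervals; near \<open>s\<close> the interval up to \<open>s + 1\<close> is the half-line.\<close>
    have "((\<lambda>u. integral {0..u} (\<lambda>r. exp r *\<^sub>R F (unweight v r))) has_vector_derivative
        exp s *\<^sub>R F (unweight v s)) (at s within {0..s+1})"
      by (rule integral_has_vector_derivative[OF integrand_cont[OF v]]) (use s in auto)
    then have "((\<lambda>u. integral {0..u} (\<lambda>r. exp r *\<^sub>R F (unweight v r))) has_vector_derivative
        exp s *\<^sub>R F (unweight v s)) (at s within {0..} \<inter> {..<s+1})"
      by (rule has_vector_derivative_within_subset) auto
    moreover have "at s within {0..} \<inter> {..<s+1} = at s within {0..}"
      by (rule at_within_nhd[where S = "{..<s+1}"]) auto
    ultimately have I: "((\<lambda>u. integral {0..u} (\<lambda>r. exp r *\<^sub>R F (unweight v r))) has_vector_derivative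
        exp s *\<^sub>R F (unweight v s)) (at s within {0..})"
      by simp
    have E: "((\<lambda>u. exp (- u)) has_real_derivative - exp (- s)) (at s within {0..})"
      by (auto intro!: derivative_eq_intros)
    show ?thesis
      unfolding P_def
      by (rule has_vector_derivative_eq_rhs[OF has_vector_derivative_scaleR[OF E
              has_vector_derivative_add[OF has_vector_derivative_const I]]])
        (simp flip: exp_add)
  qed
  obtain B where B: "\<And>x. x \<in> S \<Longrightarrow> norm x \<le> B"
    using S(1) compact_imp_bounded bounded_iff by metis
  have q_bcont: "q v \<in> bcontfun" if v: "v \<in> V" for v
  proof (rule bcontfun_normI)
    have "continuous_on {0..} (P (unweight v))"
      using dP[OF v] has_vector_derivative_continuous
      unfolding continuous_on_eq_continuous_within by fastforce
    then have "continuous_on UNIV (\<lambda>s. P (unweight v) (max 0 s))"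
      by (rule continuous_on_compose2) (auto intro!: continuous_intros)
    then show "continuous_on UNIV (q v)"
      unfolding q_def by (intro continuous_intros)
    fix s
    have "norm (q v s) = exp (- \<kappa> * max 0 s) * norm (P (unweight v) (max 0 s))"
      by (simp add: q_def)
    also have "\<dots> \<le> 1 * B"
      using \<kappa> by (intro mult_mono B PS v) auto
    finally show "norm (q v s) \<le> B" by simp
  qed
  have apply_q: "apply_bcontfun (Bcontfun (q v)) = q v" if "v \<in> V" for v
    by (rule Bcontfun_inverse[OF q_bcont[OF that]])
  have unweight_q: "unweight (Bcontfun (q v)) s = P (unweight v) s" if "v \<in> V" "0 \<le> s" for v s
  proof -
    have "unweight (Bcontfun (q v)) s = exp (\<kappa> * s) *\<^sub>R q v s"
      using apply_q[OF that(1)] by (simp add: unweight_def)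
    also have "\<dots> = P (unweight v) s"
      using that(2) by (simp add: q_def flip: exp_add)
    finally show ?thesis .
  qed
  have "\<exists>!v\<in>V. Bcontfun (q v) = v"
  proof (rule Banach_fix)
    have "V = (\<Inter>r\<in>{0..}. (\<lambda>v. unweight v r) -` S)"
      by (auto simp: V_def)
    moreover have "closed ((\<lambda>v. unweight v r) -` S)" for r
    proof (rule continuous_closed_vimage[OF \<open>closed S\<close>])
      fix v :: "real \<Rightarrow>\<^sub>C 'a"
      have "isCont (\<lambda>v. apply_bcontfun v r) v"
        using lipschitz_on_continuous_on[OF lipschitz_onI[of UNIV "\<lambda>v::real \<Rightarrow>\<^sub>C 'a. apply_bcontfun v r" 1]]
        by (simp add: dist_bounded continuous_on_eq_continuous_at)
      then show "isCont (\<lambda>v. unweight v r) v"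
        unfolding unweight_def by (intro continuous_intros)
    qed
    ultimately have "closed V" by auto
    then show "complete V" by (simp add: complete_eq_closed)
    show "V \<noteq> {}"
    proof -
      have "(\<lambda>s. exp (- \<kappa> * max 0 s) *\<^sub>R x0) \<in> bcontfun"
        by (rule bcontfun_normI[where b = "norm x0"])
          (use \<kappa> in \<open>auto intro!: continuous_intros mult_left_le_one_le\<close>)
      then have "Bcontfun (\<lambda>s. exp (- \<kappa> * max 0 s) *\<^sub>R x0) \<in> V"
        using x0 by (auto simp: V_def unweight_def Bcontfun_inverse simp flip: exp_add)
      then show ?thesis by blast
    qed
    show "0 \<le> L / \<kappa>" "L / \<kappa> < 1"
      using L \<kappa> by (auto simp: \<kappa>_def field_simps)
    show "(\<lambda>v. Bcontfun (q v)) ` V \<subseteq> V"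
    proof (rule image_subsetI)
      fix v assume "v \<in> V"
      then show "Bcontfun (q v) \<in> V"
        using unweight_q PS by (subst V_def) simp
    qed
    fix v v' assume v: "v \<in> V" "v' \<in> V"
    have S': "unweight v r \<in> S" "unweight v' r \<in> S" if "0 \<le> r" for r
      using v that by (auto simp: V_def)
    have "dist (q v s) (q v' s) \<le> L / \<kappa> * dist v v'" for s
    proof -
      define p where "p = max 0 s"
      have p: "0 \<le> p" by (simp add: p_def)
      have *: "norm (exp r *\<^sub>R F (unweight v r) - exp r *\<^sub>R F (unweight v' r))
          \<le> exp p * (L * dist v v') * exp (\<kappa> * r)" if r: "r \<in> {0..p}" for r
      proof -
        have "dist (F (unweight v r)) (F (unweight v' r)) \<le> L * dist (unweight v r) (unweight v' r)"
          using S' r by (intro lipschitz_onD[OF lip]) auto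
        also have "dist (unweight v r) (unweight v' r) = exp (\<kappa> * r) * dist (apply_bcontfun v r) (apply_bcontfun v' r)"
          by (simp add: unweight_def dist_norm flip: scaleR_diff_right)
        also have "L * \<dots> \<le> L * (exp (\<kappa> * r) * dist v v')"
          using L by (intro mult_left_mono dist_bounded) auto
        finally have "exp r * dist (F (unweight v r)) (F (unweight v' r)) \<le> exp p * (L * (exp (\<kappa> * r) * dist v v'))"
          using r by (intro mult_mono) auto
        then show ?thesis
          by (simp add: dist_norm ac_simps flip: scaleR_diff_right)
      qed
      have "norm (integral {0..p} (\<lambda>r. exp r *\<^sub>R F (unweight v r)) - integral {0..p} (\<lambda>r. exp r *\<^sub>R F (unweight v' r)))
         = norm (integral {0..p} (\<lambda>r. exp r *\<^sub>R F (unweight v r) - exp r *\<^sub>R F (unweight v' r)))"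
        by (subst Henstock_Kurzweil_Integration.integral_diff) (intro integrable_continuous_real integrand_cont v refl)+
      also have "\<dots> \<le> integral {0..p} (\<lambda>r. exp p * (L * dist v v') * exp (\<kappa> * r))"
      proof (rule integral_norm_bound_integral[OF _ _ *])
        show "(\<lambda>r. exp r *\<^sub>R F (unweight v r) - exp r *\<^sub>R F (unweight v' r)) integrable_on {0..p}"
          by (intro integrable_continuous_real continuous_on_diff integrand_cont v)
        show "(\<lambda>r. exp p * (L * dist v v') * exp (\<kappa> * r)) integrable_on {0..p}"
          by (intro integrable_continuous_real continuous_intros)
      qed
      also have "\<dots> = exp p * (L * dist v v') * ((exp (\<kappa> * p) - 1) / \<kappa>)"
        using \<kappa> by (intro integral_unique has_integral_mult_right integral_exp_real p) auto
      also have "\<dots> \<le> exp p * (L * dist v v') * (exp (\<kappa> * p) / \<kappa>)"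
        using \<kappa> L by (intro mult_left_mono divide_right_mono) auto
      finally have le: "norm (integral {0..p} (\<lambda>r. exp r *\<^sub>R F (unweight v r)) - integral {0..p} (\<lambda>r. exp r *\<^sub>R F (unweight v' r)))
         \<le> exp p * (L * dist v v') * (exp (\<kappa> * p) / \<kappa>)" .
      have "dist (q v s) (q v' s) = exp (- \<kappa> * p) * (exp (- p) *
         norm (integral {0..p} (\<lambda>r. exp r *\<^sub>R F (unweight v r)) - integral {0..p} (\<lambda>r. exp r *\<^sub>R F (unweight v' r))))"
        by (simp add: q_def P_def p_def dist_norm flip: scaleR_diff_right)
      also have "\<dots> \<le> exp (- \<kappa> * p) * (exp (- p) * (exp p * (L * dist v v') * (exp (\<kappa> * p) / \<kappa>)))"
        using le by (intro mult_left_mono) auto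
      also have "\<dots> = (exp (- \<kappa> * p) * exp (\<kappa> * p)) * (exp (- p) * exp p) * (L / \<kappa> * dist v v')"
        by simp
      also have "\<dots> = L / \<kappa> * dist v v'"
        by (simp flip: exp_add)
      finally show ?thesis .
    qed
    then show "dist (Bcontfun (q v)) (Bcontfun (q v')) \<le> L / \<kappa> * dist v v'"
      using v by (intro dist_bound) (simp add: apply_q)
  qed
  then obtain v where v: "v \<in> V" and v_fixed: "Bcontfun (q v) = v" by blast
  have x: "unweight v s = P (unweight v) s" if "0 \<le> s" for s
    using unweight_q[OF v that] v_fixed by simp
  have "(unweight v has_vector_derivative F (unweight v s) - unweight v s) (at s within {0..})"
    if "0 \<le> s" for s
    by (rule has_vector_derivative_transform[OF _ x, of s "{0..}"])
      (use dP[OF v that] x that in auto)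
  moreover have "unweight v 0 = x0"
    using x[of 0] by (simp add: P_def)
  ultimately show ?thesis
    using v by (auto simp: V_def)
qed

section \<open>The population and the payoff under the control that always prefers one strategy\<close>

text \<open>Quantifiers over states are kept whole; most arguments below are uniform in the state.\<close>

declare split_paired_All [simp del] split_paired_Ex [simp del]

lemma UNIV_status: "(UNIV :: status set) = {Infected, Susceptible}"
  using status.exhaust by auto

lemma sum_status: "(\<Sum>m\<in>UNIV. f m) = f Infected + f Susceptible"
  by (simp add: UNIV_status)

lemma sum_states: "(\<Sum>z\<in>UNIV. f z) = (\<Sum>k\<in>UNIV. f (k, Infected)) + (\<Sum>k\<in>UNIV. f (k, Susceptible))"
proof -
  have "(\<Sum>z\<in>UNIV. f z) = (\<Sum>k\<in>UNIV. \<Sum>m\<in>UNIV. f (k, m))"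
    by (simp add: sum.cartesian_product)
  then show ?thesis
    by (simp add: sum_status sum.distrib)
qed

lemma sum_of_bool_eq: "(\<Sum>z\<in>(UNIV::'z::finite set). a * of_bool (z = p) * f z) = (a * f p :: real)"
proof -
  have "(\<Sum>z\<in>(UNIV::'z set). a * of_bool (z = p) * f z) = (\<Sum>z\<in>(UNIV::'z set). if z = p then a * f z else 0)"
    by (intro sum.cong) auto
  then show ?thesis by simp
qed

lemma switch_gain_eq: "switch_gain u g (j, m) = g (u (j, m), m) - g (j, m)"
  using sum_of_bool_eq[of 1 "u (j, m)" "\<lambda>k. g (k, m) - g (j, m)"] by (simp add: eq_commute)

lemma minimizing_u_hat_iff:
  fixes g :: "'d::finite state \<Rightarrow> real"
  shows "minimizing (u_hat i) g \<longleftrightarrow> (\<forall>j m. g (i, m) \<le> g (j, m))"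
proof
  assume L: "minimizing (u_hat i) g"
  show "\<forall>j m. g (i, m) \<le> g (j, m)"
  proof (intro allI)
    fix j m
    have "switch_gain (u_hat i) g (i, m) = Min (range (\<lambda>u. switch_gain u g (i, m)))"
      using L by (simp only: minimizing_def min_switch_gain_def)
    also have "\<dots> \<le> switch_gain (u_hat j) g (i, m)"
      by (rule Min_le) auto
    finally have "switch_gain (u_hat i) g (i, m) \<le> switch_gain (u_hat j) g (i, m)" .
    then show "g (i, m) \<le> g (j, m)"
      by (simp add: switch_gain_eq u_hat_def del: switch_gain.simps)
  qed
next
  assume R: "\<forall>j m. g (i, m) \<le> g (j, m)"
  have "Min (range (\<lambda>u. switch_gain u g z)) = switch_gain (u_hat i) g z" for z
    using R by (intro Min_eqI) (cases z; auto simp: switch_gain_eq u_hat_def simp del: switch_gain.simps)+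
  then show "minimizing (u_hat i) g"
    by (simp add: minimizing_def min_switch_gain_def)
qed

lemma distribution_bounds:
  assumes "distribution x"
  shows "0 \<le> x z" "x z \<le> 1"
    and "(\<Sum>k\<in>UNIV. x (k, Infected)) + (\<Sum>k\<in>UNIV. x (k, Susceptible)) = 1"
    and "(\<Sum>k\<in>UNIV. x (k, m)) \<le> 1"
proof -
  show nn: "0 \<le> x z" for z
    using assms unfolding distribution_def by blast
  show "x z \<le> 1"
    using member_le_sum[of z UNIV x] assms nn by (simp add: distribution_def)
  show s: "(\<Sum>k\<in>UNIV. x (k, Infected)) + (\<Sum>k\<in>UNIV. x (k, Susceptible)) = 1"
    using assms by (simp add: distribution_def sum_states)
  have "0 \<le> (\<Sum>k\<in>UNIV. x (k, m))" for m
    by (intro sum_nonneg nn)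
  from this[of Infected] this[of Susceptible] s show "(\<Sum>k\<in>UNIV. x (k, m)) \<le> 1"
    by (cases m) auto
qed

text \<open>
  The situation for one fixed and sufficiently small \<open>\<beta>\<close>. The number \<open>B\<close> bounds all \<open>\<beta> k j\<close>, and with
  them the infection pressure on every strategy, since the infected fractions add up to at most 1. The cost conditions are those of the theorem multiplied out, with \<open>B\<close> as the
  price of the interaction. The condition on \<open>B\<close> and the rates of strategy \<open>i\<close> makes the
  infected fraction contract to its fixed point.
\<close>

locale dominant_strategy =
  fixes lam \<delta> B :: real
    and qp qm :: "'d::finite \<Rightarrow> real"
    and w :: "'d state \<Rightarrow> real"
    and \<beta> :: "'d \<Rightarrow> 'd \<Rightarrow> real"
    and i :: 'd
  assumes \<delta>: "0 < \<delta>" and lam: "0 < lam"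
    and qp: "0 < qp j" and qm: "0 < qm j"
    and cost_gap: "w (i, Susceptible) < w (i, Infected)"
    and \<beta>_nonneg: "0 \<le> \<beta> k j" and \<beta>_le: "\<beta> k j \<le> B"
    and B_lt: "B < qp i + qm i"
    and qp_i_le: "qp i \<le> qp j" and qm_le_i: "qm j \<le> qm i"
    and infected_cost: "j \<noteq> i \<Longrightarrow>
      (qp j - qp i) * ((w (i, Infected) - w (i, Susceptible)) / (qm i + qp i + \<delta>))
        \<le> w (j, Infected) - w (i, Infected)"
    and susceptible_cost: "j \<noteq> i \<Longrightarrow>
      (qm i - qm j + B) * ((w (i, Infected) - w (i, Susceptible)) / (qm i + qp i + \<delta>))
        \<le> w (j, Susceptible) - w (i, Susceptible)"
begin

text \<open>The stationary cost of being infected rather than susceptible in strategy \<open>i\<close> without interaction.\<close>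

definition gap_bound :: real where
  "gap_bound = (w (i, Infected) - w (i, Susceptible)) / (qm i + qp i + \<delta>)"

definition pressure :: "('d state \<Rightarrow> real) \<Rightarrow> 'd \<Rightarrow> real" where
  "pressure x j = (\<Sum>k\<in>UNIV. \<beta> k j * x (k, Infected))"

text \<open>The rate matrix of an individual agent under \<^term>\<open>u_hat i\<close>, given the infection pressures \<open>b\<close>.\<close>

fun jump_rate :: "('d \<Rightarrow> real) \<Rightarrow> 'd state \<Rightarrow> 'd state \<Rightarrow> real" where
  "jump_rate b (j, Infected) z =
     lam * of_bool (z = (i, Infected)) + qp j * of_bool (z = (j, Susceptible))"
| "jump_rate b (j, Susceptible) z =
     lam * of_bool (z = (i, Susceptible)) + (qm j + b j) * of_bool (z = (j, Infected))"

text \<open>The time derivative that the HJB equation prescribes for a payoff for which \<^term>\<open>u_hat i\<close> is minimizing.\<close>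

definition payoff_slope :: "('d \<Rightarrow> real) \<Rightarrow> ('d state \<Rightarrow> real) \<Rightarrow> 'd state \<Rightarrow> real" where
  "payoff_slope b g z = \<delta> * g z - (\<Sum>z'\<in>UNIV. jump_rate b z z' * (g z' - g z)) - w z"

lemma B_nonneg: "0 \<le> B"
  using \<beta>_nonneg \<beta>_le order_trans by blast

lemma rates_le_sum: "qp j + qm j \<le> (\<Sum>j\<in>UNIV. qp j + qm j)"
  by (rule member_le_sum) (auto intro!: add_nonneg_nonneg less_imp_le[OF qp] less_imp_le[OF qm])

lemma gap_bound_pos: "0 < gap_bound"
  using cost_gap qm[of i] qp[of i] \<delta> by (simp add: gap_bound_def)

lemma pressure_bounds:
  assumes "distribution x"
  shows "0 \<le> pressure x j" "pressure x j \<le> B"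
proof -
  show "0 \<le> pressure x j"
    unfolding pressure_def using distribution_bounds[OF assms] \<beta>_nonneg by (intro sum_nonneg) auto
  have "pressure x j \<le> (\<Sum>k\<in>UNIV. B * x (k, Infected))"
    unfolding pressure_def using distribution_bounds[OF assms] \<beta>_le by (intro sum_mono mult_right_mono) auto
  also have "\<dots> \<le> B * 1"
    using distribution_bounds(4)[OF assms] B_nonneg by (simp flip: sum_distrib_left add: mult_left_le)
  finally show "pressure x j \<le> B" by simp
qed

lemma payoff_slope_simps:
  "payoff_slope b g (j, Infected) = \<delta> * g (j, Infected) - lam * (g (i, Infected) - g (j, Infected))
     - qp j * (g (j, Susceptible) - g (j, Infected)) - w (j, Infected)"
  "payoff_slope b g (j, Susceptible) = \<delta> * g (j, Susceptible)
     - lam * (g (i, Susceptible) - g (j, Susceptible))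
     - (qm j + b j) * (g (j, Infected) - g (j, Susceptible)) - w (j, Susceptible)"
proof -
  have two: "(\<Sum>z\<in>(UNIV :: 'd state set). (l * of_bool (z = p) + q * of_bool (z = p')) * f z) = l * f p + q * f p'"
    for l q :: real and p p' and f :: "'d state \<Rightarrow> real"
    using sum_of_bool_eq[of l p f] sum_of_bool_eq[of q p' f]
    by (simp add: distrib_right sum.distrib del: sum_mult_of_bool_eq sum_of_bool_mult_eq)
  show "payoff_slope b g (j, Infected) = \<delta> * g (j, Infected) - lam * (g (i, Infected) - g (j, Infected))
     - qp j * (g (j, Susceptible) - g (j, Infected)) - w (j, Infected)"
    unfolding payoff_slope_def jump_rate.simps two by simp
  show "payoff_slope b g (j, Susceptible) = \<delta> * g (j, Susceptible)
     - lam * (g (i, Susceptible) - g (j, Susceptible))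
     - (qm j + b j) * (g (j, Infected) - g (j, Susceptible)) - w (j, Susceptible)"
    unfolding payoff_slope_def jump_rate.simps two by simp
qed

lemma hjb_iff_payoff_slope:
  assumes "minimizing (u_hat i) g"
  shows "d + hjb_lhs lam qp qm w \<beta> x g z = \<delta> * g z \<longleftrightarrow> d = payoff_slope (pressure x) g z"
proof -
  have gain: "min_switch_gain g (j, m) = g (i, m) - g (j, m)" for j m
    using assms switch_gain_eq[of "u_hat i" g j m] unfolding minimizing_def u_hat_def by metis
  obtain j m where "z = (j, m)" by (cases z)
  then show ?thesis
    by (cases m) (auto simp: gain payoff_slope_simps pressure_def algebra_simps)
qed

definition infection_flow :: "('d state \<Rightarrow> real) \<Rightarrow> 'd \<Rightarrow> real" where
  "infection_flow x j = x (j, Susceptible) * (qm j + pressure x j) - x (j, Infected) * qp j"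

abbreviation drift :: "('d state \<Rightarrow> real) \<Rightarrow> 'd state \<Rightarrow> real" where
  "drift \<equiv> evolution_rhs lam qp qm \<beta> (u_hat i)"

lemma drift_simps:
  "drift x (j, Infected) = lam * (of_bool (j = i) * (\<Sum>k\<in>UNIV. x (k, Infected)) - x (j, Infected))
     + infection_flow x j"
  "drift x (j, Susceptible) = lam * (of_bool (j = i) * (\<Sum>k\<in>UNIV. x (k, Susceptible)) - x (j, Susceptible))
     - infection_flow x j"
proof -
  have s: "(\<Sum>k\<in>UNIV. x (k, m)) = x (j, m) + (\<Sum>k\<in>UNIV - {j}. x (k, m))" for m
    by (rule sum.remove) auto
  have sw: "(\<Sum>k\<in>UNIV - {j}. x (k, m) * of_bool (u_hat i (k, m) = j))
     - (\<Sum>k\<in>UNIV - {j}. x (j, m) * of_bool (u_hat i (j, m) = k))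
     = of_bool (j = i) * (\<Sum>k\<in>UNIV. x (k, m)) - x (j, m)" for m
  proof (cases "j = i")
    case True
    have "(\<Sum>k\<in>UNIV - {j}. x (j, m) * of_bool (u_hat i (j, m) = k)) = 0"
      using True by (intro sum.neutral) (auto simp: u_hat_def)
    then show ?thesis using True s[of m] by (simp add: u_hat_def)
  next
    case False
    have "(\<Sum>k\<in>UNIV - {j}. x (j, m) * of_bool (u_hat i (j, m) = k))
        = (\<Sum>k\<in>UNIV - {j}. if k = i then x (j, m) else 0)"
      by (intro sum.cong) (auto simp: u_hat_def)
    then show ?thesis using False by (simp add: u_hat_def)
  qed
  have inf: "(\<Sum>k\<in>UNIV. x (j, Susceptible) * x (k, Infected) * \<beta> k j) = x (j, Susceptible) * pressure x j"
    by (simp add: pressure_def sum_distrib_left mult.assoc mult.commute[of "\<beta> _ _"])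
  show "drift x (j, Infected) = lam * (of_bool (j = i) * (\<Sum>k\<in>UNIV. x (k, Infected)) - x (j, Infected))
     + infection_flow x j"
    unfolding evolution_rhs.simps inf sw[symmetric]
    by (simp add: infection_flow_def algebra_simps)
  show "drift x (j, Susceptible) = lam * (of_bool (j = i) * (\<Sum>k\<in>UNIV. x (k, Susceptible)) - x (j, Susceptible))
     - infection_flow x j"
    unfolding evolution_rhs.simps inf sw[symmetric]
    by (simp add: infection_flow_def algebra_simps)
qed

definition population_path :: "real \<Rightarrow> real \<Rightarrow> (real \<Rightarrow> 'd state \<Rightarrow> real) \<Rightarrow> bool" where
  "population_path t T x \<longleftrightarrow> (\<forall>s\<in>{t..T}. distribution (x s) \<and>
     (\<forall>z. ((\<lambda>r. x r z) has_real_derivative drift (x s) z) (at s within {t..T})))"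

definition payoff_path :: "real \<Rightarrow> real \<Rightarrow> (real \<Rightarrow> 'd \<Rightarrow> real) \<Rightarrow> (real \<Rightarrow> 'd state \<Rightarrow> real) \<Rightarrow> bool" where
  "payoff_path t T b g \<longleftrightarrow> (\<forall>s\<in>{t..T}. \<forall>z.
     ((\<lambda>r. g r z) has_real_derivative payoff_slope (b s) (g s) z) (at s within {t..T}))"

text \<open>
  The consistency equation decouples: the forward equation does not mention \<open>g\<close>, the backward equation is
  linear, and minimality of the control becomes a family of inequalities.
\<close>

lemma mfg_solution_u_hat_iff:
  assumes u: "\<forall>s\<in>{t..T}. u s = u_hat i"
  shows "mfg_solution lam qp qm w \<delta> \<beta> t T x0 gT x u g \<longleftrightarrow>
    x t = x0 \<and> g T = gT \<and> population_path t T x \<and> payoff_path t T (\<lambda>s. pressure (x s)) g \<and>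
    (\<forall>s\<in>{t..T}. \<forall>j m. g s (i, m) \<le> g s (j, m))"
proof -
  have "(distribution (x s) \<and>
      (\<forall>z. ((\<lambda>r. x r z) has_real_derivative evolution_rhs lam qp qm \<beta> (u s) (x s) z) (at s within {t..T})) \<and>
      (\<forall>z. \<exists>g'. ((\<lambda>r. g r z) has_real_derivative g') (at s within {t..T}) \<and>
         g' + hjb_lhs lam qp qm w \<beta> (x s) (g s) z = \<delta> * g s z) \<and>
      minimizing (u s) (g s)) \<longleftrightarrow>
      (distribution (x s) \<and>
      (\<forall>z. ((\<lambda>r. x r z) has_real_derivative drift (x s) z) (at s within {t..T})) \<and>
      (\<forall>z. ((\<lambda>r. g r z) has_real_derivative payoff_slope (pressure (x s)) (g s) z) (at s within {t..T})) \<and>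
      (\<forall>j m. g s (i, m) \<le> g s (j, m)))" if "s \<in> {t..T}" for s
  proof (cases "minimizing (u_hat i) (g s)")
    case True
    then show ?thesis
      using u that minimizing_u_hat_iff[of i "g s"] hjb_iff_payoff_slope[OF True] by simp
  next
    case False
    then show ?thesis
      using u that minimizing_u_hat_iff[of i "g s"] by metis
  qed
  then show ?thesis
    unfolding mfg_solution_def population_path_def payoff_path_def by blast
qed

lemma pressure_diff:
  assumes "\<And>k. \<bar>x (k, Infected) - y (k, Infected)\<bar> \<le> \<rho>"
  shows "\<bar>pressure x j - pressure y j\<bar> \<le> real CARD('d) * B * \<rho>"
proof -
  have "\<bar>pressure x j - pressure y j\<bar> = \<bar>\<Sum>k\<in>UNIV. \<beta> k j * (x (k, Infected) - y (k, Infected))\<bar>"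
    by (simp add: pressure_def right_diff_distrib sum_subtractf)
  also have "\<dots> \<le> (\<Sum>k\<in>UNIV. \<bar>\<beta> k j * (x (k, Infected) - y (k, Infected))\<bar>)"
    by (rule sum_abs)
  also have "\<dots> \<le> (\<Sum>k\<in>(UNIV::'d set). B * \<rho>)"
    using assms \<beta>_nonneg \<beta>_le B_nonneg by (intro sum_mono) (auto simp: abs_mult intro!: mult_mono)
  finally show ?thesis by simp
qed

lemma drift_lipschitz:
  obtains K where "0 \<le> K" "\<And>x y z. distribution x \<Longrightarrow> distribution y \<Longrightarrow>
    \<bar>drift x z - drift y z\<bar> \<le> K * (\<Sum>z'\<in>UNIV. \<bar>x z' - y z'\<bar>)"
proof
  define K where "K = 2 * lam + (\<Sum>j\<in>UNIV. qp j + qm j) + 2 * (real CARD('d) * B) + B"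
  note q = rates_le_sum
  show "0 \<le> K"
    using lam B_nonneg q[of i] qp[of i] qm[of i] unfolding K_def by (simp add: add_nonneg_nonneg)
  fix x y :: "'d state \<Rightarrow> real" and z :: "'d state"
  assume dx: "distribution x" and dy: "distribution y"
  define N where "N = (\<Sum>z'\<in>UNIV. \<bar>x z' - y z'\<bar>)"
  have N: "\<bar>x z' - y z'\<bar> \<le> N" for z'
    unfolding N_def using member_le_sum[of z' UNIV "\<lambda>z'. \<bar>x z' - y z'\<bar>"] by simp
  then have N0: "0 \<le> N" using abs_ge_zero order_trans by blast
  have sums: "\<bar>(\<Sum>k\<in>UNIV. x (k, m)) - (\<Sum>k\<in>UNIV. y (k, m))\<bar> \<le> N" for m
  proof -
    have "\<bar>(\<Sum>k\<in>UNIV. x (k, m)) - (\<Sum>k\<in>UNIV. y (k, m))\<bar> \<le> (\<Sum>k\<in>UNIV. \<bar>x (k, m) - y (k, m)\<bar>)"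
      by (simp add: sum_abs flip: sum_subtractf)
    also have "\<dots> \<le> N"
      unfolding N_def sum_states by (cases m) (auto intro!: sum_nonneg)
    finally show ?thesis .
  qed
  have switch: "\<bar>lam * (of_bool P * (\<Sum>k\<in>UNIV. x (k, m)) - x (j, m)) - lam * (of_bool P * (\<Sum>k\<in>UNIV. y (k, m)) - y (j, m))\<bar>
      \<le> 2 * lam * N" for P j m
  proof -
    have "\<bar>(of_bool P * (\<Sum>k\<in>UNIV. x (k, m)) - x (j, m)) - (of_bool P * (\<Sum>k\<in>UNIV. y (k, m)) - y (j, m))\<bar> \<le> 2 * N"
      using sums[of m] N[of "(j, m)"] by (cases P) auto
    then have "lam * \<bar>(of_bool P * (\<Sum>k\<in>UNIV. x (k, m)) - x (j, m)) - (of_bool P * (\<Sum>k\<in>UNIV. y (k, m)) - y (j, m))\<bar> \<le> lam * (2 * N)"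
      using lam by (intro mult_left_mono) auto
    then show ?thesis
      using lam by (simp add: abs_mult ac_simps flip: right_diff_distrib)
  qed
  have flow: "\<bar>infection_flow x j - infection_flow y j\<bar> \<le> (qp j + qm j + B + real CARD('d) * B) * N" for j
  proof -
    have "infection_flow x j - infection_flow y j =
        qm j * (x (j, Susceptible) - y (j, Susceptible)) - qp j * (x (j, Infected) - y (j, Infected))
      + (pressure x j * (x (j, Susceptible) - y (j, Susceptible))
      + y (j, Susceptible) * (pressure x j - pressure y j))"
      by (simp add: infection_flow_def algebra_simps)
    moreover have "\<bar>qm j * (x (j, Susceptible) - y (j, Susceptible))\<bar> \<le> qm j * N"
      "\<bar>qp j * (x (j, Infected) - y (j, Infected))\<bar> \<le> qp j * N"
      using N qp[of j] qm[of j] by (auto simp: abs_mult intro!: mult_left_mono)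
    moreover have "\<bar>pressure x j * (x (j, Susceptible) - y (j, Susceptible))\<bar> \<le> B * N"
      unfolding abs_mult using N pressure_bounds[OF dx, of j] B_nonneg by (intro mult_mono) auto
    moreover have "\<bar>y (j, Susceptible) * (pressure x j - pressure y j)\<bar> \<le> 1 * (real CARD('d) * B * N)"
      unfolding abs_mult using N distribution_bounds(1,2)[OF dy, of "(j, Susceptible)"]
      by (intro mult_mono pressure_diff) auto
    ultimately show ?thesis
      by (simp add: distrib_right)
  qed
  have K: "2 * lam * N + (qp j + qm j + B + real CARD('d) * B) * N \<le> K * N" for j
  proof -
    have "0 \<le> real CARD('d) * B" using B_nonneg by simp
    then have "2 * lam + (qp j + qm j + B + real CARD('d) * B) \<le> K"
      using q[of j] unfolding K_def by linarith
    then show ?thesis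
      using N0 unfolding distrib_right[symmetric] by (rule mult_right_mono)
  qed
  obtain j m where z: "z = (j, m)" by (cases z)
  have "\<bar>drift x z - drift y z\<bar> \<le> 2 * lam * N + (qp j + qm j + B + real CARD('d) * B) * N"
    using switch[of "j = i" m j] flow[of j] unfolding z
    by (cases m) (simp_all only: drift_simps abs_le_iff, linarith+)
  then show "\<bar>drift x z - drift y z\<bar> \<le> K * (\<Sum>z'\<in>UNIV. \<bar>x z' - y z'\<bar>)"
    using K[of j] by (simp add: N_def)
qed

lemma sum_drift: "(\<Sum>z\<in>UNIV. drift x z) = 0"
proof -
  have d: "(\<Sum>j\<in>(UNIV::'d set). of_bool (j = i) * c) = (c::real)" for c
    using sum_of_bool_eq[of 1 i "\<lambda>_. c"] by (simp del: sum_mult_of_bool_eq sum_of_bool_mult_eq)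
  show ?thesis
    unfolding sum_states drift_simps sum.distrib sum_subtractf sum_distrib_left[symmetric] d
    by simp
qed

text \<open>
  Each state is left at a rate of at most \<open>M\<close>, so a step of length \<open>1 / M\<close> along the drift stays in the
  simplex. Thus \<open>drift\<close> is \<open>M\<close> times the field \<open>F v - v\<close> for a map \<open>F\<close> of the simplex into itself, and a solution
  of \<open>X' = F X - X\<close> only has to be run at speed \<open>M\<close>.
\<close>

lemma population_path_exists:
  assumes "t < T" "distribution x0"
  obtains x where "x t = x0" "population_path t T x"
proof -
  define M where "M = lam + (\<Sum>j\<in>UNIV. qp j + qm j) + B"
  note q = rates_le_sum
  have M: "0 < M"
    using lam B_nonneg q[of i] qp[of i] qm[of i] unfolding M_def by linarith
  define S where "S = {v :: real ^ 'd state. distribution (\<lambda>z. v $ z)}"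
  define F :: "real ^ 'd state \<Rightarrow> real ^ 'd state" where
    "F = (\<lambda>v. \<chi> z. v $ z + drift (\<lambda>z. v $ z) z / M)"
  obtain K where K: "0 \<le> K" "\<And>x y z. distribution x \<Longrightarrow> distribution y \<Longrightarrow>
    \<bar>drift x z - drift y z\<bar> \<le> K * (\<Sum>z'\<in>UNIV. \<bar>x z' - y z'\<bar>)"
    using drift_lipschitz by blast
  have "S = (\<Inter>z. {v. 0 \<le> v $ z}) \<inter> {v. (\<Sum>z\<in>UNIV. v $ z) = 1}"
    by (auto simp: S_def distribution_def)
  moreover have "closed {v :: real ^ 'd state. 0 \<le> v $ z}" for z
    by (intro closed_Collect_le continuous_intros)
  moreover have "closed {v :: real ^ 'd state. (\<Sum>z\<in>UNIV. v $ z) = 1}"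
    by (intro closed_Collect_eq continuous_intros)
  ultimately have "closed S" by (auto intro!: closed_Int closed_INT)
  moreover have "bounded S"
  proof (rule boundedI)
    fix v assume "v \<in> S"
    then have v: "distribution (\<lambda>z. v $ z)" by (simp add: S_def)
    have "norm v \<le> (\<Sum>z\<in>UNIV. \<bar>v $ z\<bar>)"
      by (rule norm_le_l1_cart)
    also have "\<dots> = 1"
      using v by (simp add: distribution_def)
    finally show "norm v \<le> 1" .
  qed
  ultimately have compact: "compact S"
    by (simp add: compact_eq_bounded_closed)
  have convex: "convex S"
    by (auto simp: convex_def S_def distribution_def sum.distrib simp flip: sum_distrib_left)
  have FS: "F ` S \<subseteq> S"
  proof (rule image_subsetI)
    fix v assume "v \<in> S"
    then have v: "distribution (\<lambda>z. v $ z)" by (simp add: S_def)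
    note bd = distribution_bounds[OF v] pressure_bounds[OF v]
    have sn: "0 \<le> (\<Sum>k\<in>UNIV. v $ (k, m))" for m
      using bd(1) by (intro sum_nonneg) auto
    have "- (M * v $ z) \<le> drift (\<lambda>z. v $ z) z" for z
    proof -
      obtain j m where z: "z = (j, m)" by (cases z)
      have switch: "- (lam * v $ (j, m)) \<le> lam * (of_bool (j = i) * (\<Sum>k\<in>UNIV. v $ (k, m)) - v $ (j, m))"
        using lam sn[of m] by (simp add: right_diff_distrib)
      have flow: "- (qp j * v $ (j, Infected)) \<le> infection_flow (\<lambda>z. v $ z) j"
        "infection_flow (\<lambda>z. v $ z) j \<le> (qm j + B) * v $ (j, Susceptible)"
      proof -
        have "0 \<le> v $ (j, Susceptible) * (qm j + pressure (\<lambda>z. v $ z) j)"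
          using bd(1,5) qm[of j] by (intro mult_nonneg_nonneg add_nonneg_nonneg) auto
        then show "- (qp j * v $ (j, Infected)) \<le> infection_flow (\<lambda>z. v $ z) j"
          by (simp add: infection_flow_def mult.commute)
        have "v $ (j, Susceptible) * (qm j + pressure (\<lambda>z. v $ z) j) \<le> v $ (j, Susceptible) * (qm j + B)"
          using bd(1,6) by (intro mult_left_mono) auto
        moreover have "0 \<le> v $ (j, Infected) * qp j"
          using bd(1) qp[of j] by (intro mult_nonneg_nonneg) auto
        ultimately show "infection_flow (\<lambda>z. v $ z) j \<le> (qm j + B) * v $ (j, Susceptible)"
          by (simp add: infection_flow_def mult.commute)
      qed
      have "lam + qp j \<le> M" "lam + (qm j + B) \<le> M"
        using q[of j] qp[of j] qm[of j] B_nonneg by (auto simp: M_def)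
      from mult_right_mono[OF this(1) bd(1)[of "(j, Infected)"]]
        mult_right_mono[OF this(2) bd(1)[of "(j, Susceptible)"]]
      show ?thesis
        using switch flow unfolding z by (cases m) (simp_all add: drift_simps distrib_right del: evolution_rhs.simps)
    qed
    then have "0 \<le> F v $ z" for z
      using M by (simp add: F_def field_simps del: evolution_rhs.simps) (metis add.commute neg_le_iff_le add_uminus_conv_diff diff_ge_0_iff_ge minus_minus mult.commute)
    moreover have "(\<Sum>z\<in>UNIV. F v $ z) = 1"
      using v by (simp add: F_def sum.distrib sum_drift distribution_def flip: sum_divide_distrib)
    ultimately show "F v \<in> S"
      by (simp add: S_def distribution_def)
  qed
  define n where "n = real CARD('d state)"
  have lip: "(n * (1 + K * n / M))-lipschitz_on S F"
  proof (rule lipschitz_onI)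
    fix v v' assume "v \<in> S" "v' \<in> S"
    then have v: "distribution (\<lambda>z. v $ z)" "distribution (\<lambda>z. v' $ z)" by (simp_all add: S_def)
    have comp: "\<bar>v $ z - v' $ z\<bar> \<le> dist v v'" for z
      using component_le_norm_cart[of "v - v'" z] by (simp add: dist_norm)
    have "(\<Sum>z\<in>UNIV. \<bar>v $ z - v' $ z\<bar>) \<le> n * dist v v'"
      unfolding n_def by (rule sum_bounded_above) (rule comp)
    then have *: "\<bar>drift (\<lambda>z. v $ z) z - drift (\<lambda>z. v' $ z) z\<bar> \<le> K * (n * dist v v')" for z
      using K(2)[OF v, of z] K(1) mult_left_mono order_trans by blast
    have "norm (F v - F v') \<le> (\<Sum>z\<in>UNIV. \<bar>(F v - F v') $ z\<bar>)"
      by (rule norm_le_l1_cart)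
    also have "\<dots> \<le> n * (dist v v' + K * (n * dist v v') / M)"
      unfolding n_def
    proof (rule sum_bounded_above)
      fix z
      have "(F v - F v') $ z = (v $ z - v' $ z) + (drift (\<lambda>z. v $ z) z - drift (\<lambda>z. v' $ z) z) / M"
        by (simp add: F_def diff_divide_distrib)
      moreover have "\<bar>(drift (\<lambda>z. v $ z) z - drift (\<lambda>z. v' $ z) z) / M\<bar> \<le> K * (n * dist v v') / M"
        using * M by (simp add: divide_right_mono)
      ultimately show "\<bar>(F v - F v') $ z\<bar> \<le> dist v v' + K * (real CARD('d state) * dist v v') / M"
        using comp[of z] unfolding n_def by linarith
    qed
    finally show "dist (F v) (F v') \<le> n * (1 + K * n / M) * dist v v'"
      by (simp add: dist_norm algebra_simps)
  next
    show "0 \<le> n * (1 + K * n / M)"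
      using K(1) M by (simp add: n_def)
  qed
  have "(\<chi> z. x0 z) \<in> S"
  proof -
    have "(\<lambda>z. (\<chi> z. x0 z) $ z) = x0" by (simp add: fun_eq_iff)
    then show ?thesis using assms(2) unfolding S_def mem_Collect_eq by (simp only:)
  qed
  then obtain X where X: "X 0 = (\<chi> z. x0 z)" "\<And>s. 0 \<le> s \<Longrightarrow> X s \<in> S"
    "\<And>s. 0 \<le> s \<Longrightarrow> (X has_vector_derivative F (X s) - X s) (at s within {0..})"
    using relaxation_ode_solution_in_convex[OF compact convex FS lip] by blast
  define x where "x = (\<lambda>s z. X (M * (s - t)) $ z)"
  have "((\<lambda>r. x r z) has_real_derivative drift (x s) z) (at s within {t..T})"
    if s: "s \<in> {t..T}" for s z
  proof -
    have nn: "0 \<le> M * (r - t)" if "r \<in> {t..T}" for r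
      using that M by simp
    have "((\<lambda>r. X r $ z) has_vector_derivative (F (X (M * (s - t))) - X (M * (s - t))) $ z)
        (at (M * (s - t)) within {0..})"
      by (rule bounded_linear.has_vector_derivative[OF bounded_linear_vec_nth X(3)[OF nn[OF s]]])
    then have "((\<lambda>r. X r $ z) has_real_derivative drift (x s) z / M) (at (M * (s - t)) within {0..})"
      by (simp add: has_real_derivative_iff_has_vector_derivative F_def x_def del: evolution_rhs.simps)
    then have d: "((\<lambda>r. X r $ z) has_real_derivative drift (x s) z / M) (at (M * (s - t)) within (\<lambda>r. M * (r - t)) ` {t..T})"
      by (rule DERIV_subset) (use nn in blast)
    have "((\<lambda>r. M * (r - t)) has_real_derivative M) (at s within {t..T})"
      by (auto intro!: derivative_eq_intros)
    from DERIV_image_chain[OF d this] show ?thesis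
      using M by (simp add: o_def x_def del: evolution_rhs.simps)
  qed
  moreover have "distribution (x s)" if "s \<in> {t..T}" for s
    using X(2)[of "M * (s - t)"] that M by (simp add: S_def x_def)
  moreover have "x t = x0"
    by (simp add: fun_eq_iff x_def X(1))
  ultimately show ?thesis
    using that by (simp add: population_path_def del: evolution_rhs.simps)
qed

text \<open>Gronwall's inequality for the squared distance of the two paths.\<close>

lemma population_path_unique:
  assumes x: "population_path t T x" and y: "population_path t T y" and eq: "x t = y t"
    and s: "s \<in> {t..T}"
  shows "x s = y s"
proof -
  obtain K where K: "0 \<le> K" "\<And>x y z. distribution x \<Longrightarrow> distribution y \<Longrightarrow>
    \<bar>drift x z - drift y z\<bar> \<le> K * (\<Sum>z'\<in>UNIV. \<bar>x z' - y z'\<bar>)"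
    using drift_lipschitz by blast
  define n where "n = real CARD('d state)"
  define e where "e = (\<lambda>s z. x s z - y s z)"
  define v where "v = (\<lambda>s. \<Sum>z\<in>UNIV. (e s z)\<^sup>2)"
  have "v s \<le> (v t + 0 * (s - t)) * exp (- (- (2 * n * K)) * (s - t))"
  proof (rule gronwall_exponential[OF _ _ s])
    fix r assume r: "r \<in> {t..T}"
    have dx: "((\<lambda>r. x r z) has_real_derivative drift (x r) z) (at r within {t..T})"
      and dy: "((\<lambda>r. y r z) has_real_derivative drift (y r) z) (at r within {t..T})" for z
      using x y r by (auto simp: population_path_def simp del: evolution_rhs.simps)
    have "((\<lambda>r. (e r z)\<^sup>2) has_real_derivative 2 * e r z * (drift (x r) z - drift (y r) z)) (at r within {t..T})" for z
      using DERIV_power[OF DERIV_diff[OF dx[of z] dy[of z]], of 2] by (simp add: e_def mult_ac del: right_diff_distrib_numeral)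
    then show "(v has_real_derivative (\<Sum>z\<in>UNIV. 2 * e r z * (drift (x r) z - drift (y r) z))) (at r within {t..T})"
      unfolding v_def by (rule DERIV_sum)
    have "(\<Sum>z\<in>UNIV. 2 * e r z * (drift (x r) z - drift (y r) z))
        \<le> (\<Sum>z\<in>UNIV. \<Sum>z'\<in>UNIV. K * ((e r z)\<^sup>2 + (e r z')\<^sup>2))"
    proof (rule sum_mono)
      fix z
      have "2 * e r z * (drift (x r) z - drift (y r) z) \<le> \<bar>2 * e r z\<bar> * \<bar>drift (x r) z - drift (y r) z\<bar>"
        by (metis abs_ge_self abs_mult)
      also have "\<dots> \<le> \<bar>2 * e r z\<bar> * (K * (\<Sum>z'\<in>UNIV. \<bar>e r z'\<bar>))"
        using K(2)[of "x r" "y r" z] x y r by (intro mult_left_mono) (auto simp: population_path_def e_def simp del: evolution_rhs.simps)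
      also have "\<dots> = (\<Sum>z'\<in>UNIV. K * (2 * \<bar>e r z\<bar> * \<bar>e r z'\<bar>))"
        by (simp add: sum_distrib_left abs_mult ac_simps)
      also have "\<dots> \<le> (\<Sum>z'\<in>UNIV. K * ((e r z)\<^sup>2 + (e r z')\<^sup>2))"
      proof (intro sum_mono mult_left_mono K(1))
        fix z'
        show "2 * \<bar>e r z\<bar> * \<bar>e r z'\<bar> \<le> (e r z)\<^sup>2 + (e r z')\<^sup>2"
          using sum_squares_bound[of "\<bar>e r z\<bar>" "\<bar>e r z'\<bar>"] by simp
      qed
      finally show "2 * e r z * (drift (x r) z - drift (y r) z) \<le> (\<Sum>z'\<in>UNIV. K * ((e r z)\<^sup>2 + (e r z')\<^sup>2))" .
    qed
    also have "\<dots> = 2 * n * K * v r"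
      by (simp add: v_def n_def sum.distrib algebra_simps flip: sum_distrib_left)
    finally show "(\<Sum>z\<in>UNIV. 2 * e r z * (drift (x r) z - drift (y r) z))
        \<le> - (- (2 * n * K) * v r) + 0 * exp (- (- (2 * n * K)) * (r - t))"
      by simp
  qed
  moreover have "v t = 0"
    using eq by (simp add: v_def e_def)
  moreover have "0 \<le> v s"
    unfolding v_def by (intro sum_nonneg) auto
  ultimately have "v s = 0" by simp
  then have "e s z = 0" for z
    unfolding v_def by (subst (asm) sum_nonneg_eq_0_iff) auto
  then show ?thesis
    by (auto simp: e_def)
qed

section \<open>Convergence of the population\<close>

text \<open>
  The polynomial is negative at 0 and positive at 1, and \<open>\<beta> i i < qp i + qm i\<close> makes it strictly
  increasing on the positive axis.
\<close>

lemma x_star_root: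
  defines "y \<equiv> x_star qp qm \<beta> i"
  shows "0 < y" "y < 1" "\<beta> i i * y\<^sup>2 + y * (qp i - \<beta> i i + qm i) - qm i = 0"
proof -
  define f where "f = (\<lambda>y. \<beta> i i * y\<^sup>2 + y * (qp i - \<beta> i i + qm i) - qm i)"
  have factor: "f y - f z = (y - z) * (\<beta> i i * (y + z) + (qp i + qm i - \<beta> i i))" for y z
    by (simp add: f_def algebra_simps power2_eq_square)
  have "f 0 < 0" "0 < f 1"
    using qp[of i] qm[of i] by (auto simp: f_def)
  moreover have "continuous_on {0..1} f"
    unfolding f_def by (intro continuous_intros)
  ultimately obtain y0 where y0: "0 \<le> y0" "y0 \<le> 1" "f y0 = 0"
    using IVT'[of f 0 0 1] by auto
  then have "0 < y0" "y0 < 1"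
    using \<open>f 0 < 0\<close> \<open>0 < f 1\<close> by (auto simp: order_less_le)
  moreover have "z = y0" if "0 < z" "f z = 0" for z
  proof -
    have "0 < \<beta> i i * (z + y0) + (qp i + qm i - \<beta> i i)"
      using that \<open>0 < y0\<close> \<beta>_nonneg[of i i] \<beta>_le[of i i] B_lt by (intro add_nonneg_pos) auto
    then show ?thesis
      using factor[of z y0] that y0 by simp
  qed
  ultimately have "\<exists>!y. 0 < y \<and> y < 1 \<and> \<beta> i i * y\<^sup>2 + y * (qp i - \<beta> i i + qm i) - qm i = 0"
    using y0(3) unfolding f_def by blast
  from theI'[OF this] show "0 < y" "y < 1" "\<beta> i i * y\<^sup>2 + y * (qp i - \<beta> i i + qm i) - qm i = 0"
    unfolding y_def x_star_def by auto
qed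

lemma distribution_x_bar: "distribution (x_bar qp qm \<beta> i)"
proof -
  have "(\<Sum>k\<in>UNIV. x_bar qp qm \<beta> i (k, m)) = (case m of Infected \<Rightarrow> x_star qp qm \<beta> i | Susceptible \<Rightarrow> 1 - x_star qp qm \<beta> i)" for m
  proof -
    have "x_bar qp qm \<beta> i (k, m) =
        (if k = i then case m of Infected \<Rightarrow> x_star qp qm \<beta> i | Susceptible \<Rightarrow> 1 - x_star qp qm \<beta> i else 0)" for k
      by (simp add: x_bar_def)
    then show ?thesis by simp
  qed
  then have "(\<Sum>z\<in>UNIV. x_bar qp qm \<beta> i z) = 1"
    by (simp add: sum_states)
  moreover have "0 \<le> x_bar qp qm \<beta> i z" for z
    using x_star_root by (cases z; cases "snd z") (auto simp: x_bar_def)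
  ultimately show ?thesis
    by (simp add: distribution_def)
qed

text \<open>
  Infections and recoveries do not change the strategy, and everybody outside \<open>i\<close> moves to \<open>i\<close> at rate
  \<open>lam\<close>. Hence the mass \<open>p\<close> outside strategy \<open>i\<close> satisfies \<open>p' = - (lam * p)\<close>.
\<close>

lemma mass_elsewhere:
  assumes x: "population_path t T x" and s: "s \<in> {t..T}"
  defines "p \<equiv> 1 - x s (i, Infected) - x s (i, Susceptible)"
  shows "0 \<le> p" "p \<le> exp (- lam * (s - t))"
    and "j \<noteq> i \<Longrightarrow> x s (j, m) \<le> p"
    and "(\<Sum>k\<in>UNIV - {i}. x s (k, Infected)) \<le> p"
proof -
  have d: "distribution (x r)" if "r \<in> {t..T}" for r
    using x that by (simp add: population_path_def del: evolution_rhs.simps)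
  have split: "(\<Sum>k\<in>UNIV. x s (k, m)) = x s (i, m) + (\<Sum>k\<in>UNIV - {i}. x s (k, m))" for m
    by (rule sum.remove) auto
  have p: "p = (\<Sum>k\<in>UNIV - {i}. x s (k, Infected)) + (\<Sum>k\<in>UNIV - {i}. x s (k, Susceptible))"
    using distribution_bounds(3)[OF d[OF s]] split by (simp add: p_def)
  have nn: "0 \<le> (\<Sum>k\<in>UNIV - {i}. x s (k, m))" for m
    by (intro sum_nonneg distribution_bounds d s)
  show "0 \<le> p" "(\<Sum>k\<in>UNIV - {i}. x s (k, Infected)) \<le> p"
    using nn[of Infected] nn[of Susceptible] by (simp_all add: p)
  show "x s (j, m) \<le> p" if "j \<noteq> i"
  proof -
    have "x s (j, m) \<le> (\<Sum>k\<in>UNIV - {i}. x s (k, m))"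
      using that by (intro member_le_sum distribution_bounds d s) auto
    then show ?thesis
      using nn[of Infected] nn[of Susceptible] by (cases m) (auto simp: p)
  qed
  have "p \<le> ((1 - x t (i, Infected) - x t (i, Susceptible)) + 0 * (s - t)) * exp (- lam * (s - t))"
    unfolding p_def
  proof (rule gronwall_exponential[OF _ _ s])
    fix r assume r: "r \<in> {t..T}"
    have dx: "((\<lambda>r. x r z) has_real_derivative drift (x r) z) (at r within {t..T})" for z
      using x r by (simp add: population_path_def del: evolution_rhs.simps)
    show "((\<lambda>r. 1 - x r (i, Infected) - x r (i, Susceptible)) has_real_derivative
        0 - drift (x r) (i, Infected) - drift (x r) (i, Susceptible)) (at r within {t..T})"
      by (intro DERIV_diff DERIV_const dx)
    show "0 - drift (x r) (i, Infected) - drift (x r) (i, Susceptible)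
        \<le> - (lam * (1 - x r (i, Infected) - x r (i, Susceptible))) + 0 * exp (- lam * (r - t))"
      using arg_cong[OF distribution_bounds(3)[OF d[OF r]], of "\<lambda>c. lam * c"]
      by (simp add: drift_simps algebra_simps del: evolution_rhs.simps)
  qed
  also have "\<dots> \<le> 1 * exp (- lam * (s - t))"
    using s distribution_bounds(1)[OF d[of t], of "(i, Infected)"]
      distribution_bounds(1)[OF d[of t], of "(i, Susceptible)"] by (intro mult_right_mono) auto
  finally show "p \<le> exp (- lam * (s - t))" by simp
qed

text \<open>
  If all agents used strategy \<open>i\<close>, the drift of the infected fraction \<open>y\<close> would be minus the polynomial
  that defines \<open>y0\<close>, hence a multiple of \<open>y - y0\<close>. The other agents perturb it by a multiple of their mass \<open>p\<close>.
\<close>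

lemma drift_infected_near_root:
  assumes x: "distribution x"
  defines "p \<equiv> 1 - x (i, Infected) - x (i, Susceptible)"
    and "y \<equiv> x (i, Infected)" and "y0 \<equiv> x_star qp qm \<beta> i"
  assumes p: "(\<Sum>k\<in>UNIV - {i}. x (k, Infected)) \<le> p"
  shows "\<bar>drift x (i, Infected) + (y - y0) * (\<beta> i i * (y + y0) + (qp i + qm i - \<beta> i i))\<bar>
    \<le> (lam + qm i + 2 * B) * p"
proof -
  note bd = distribution_bounds[OF x]
  define m where "m = (\<Sum>k\<in>UNIV - {i}. x (k, Infected))"
  define R where "R = (\<Sum>k\<in>UNIV - {i}. \<beta> k i * x (k, Infected))"
  have m: "0 \<le> m" "m \<le> p"
    using p bd(1) by (auto simp: m_def intro!: sum_nonneg)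
  have R0: "0 \<le> R"
    unfolding R_def using bd(1) \<beta>_nonneg by (intro sum_nonneg) auto
  have "R \<le> (\<Sum>k\<in>UNIV - {i}. B * x (k, Infected))"
    unfolding R_def using bd(1) \<beta>_le by (intro sum_mono mult_right_mono) auto
  also have "\<dots> = B * m"
    by (simp add: m_def sum_distrib_left)
  also have "\<dots> \<le> B * p"
    using m B_nonneg by (intro mult_left_mono)
  finally have R1: "R \<le> B * p" .
  have pressure: "pressure x i = \<beta> i i * y + R"
    unfolding pressure_def R_def y_def by (subst sum.remove[of _ i]) auto
  have tot: "(\<Sum>k\<in>UNIV. x (k, Infected)) = y + m"
    unfolding m_def y_def by (subst sum.remove[of _ i]) auto
  have root: "\<beta> i i * y0\<^sup>2 + y0 * (qp i - \<beta> i i + qm i) - qm i = 0"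
    unfolding y0_def by (rule x_star_root)
  have s: "x (i, Susceptible) = 1 - p - y"
    by (simp add: p_def y_def)
  have "drift x (i, Infected) = lam * m + (1 - p - y) * (qm i + (\<beta> i i * y + R)) - y * qp i"
    unfolding drift_simps infection_flow_def pressure tot s by (simp add: y_def)
  also have "\<dots> + (y - y0) * (\<beta> i i * (y + y0) + (qp i + qm i - \<beta> i i))
      = lam * m - p * (qm i + pressure x i) + (1 - y) * R
        - (\<beta> i i * y0\<^sup>2 + y0 * (qp i - \<beta> i i + qm i) - qm i)"
    unfolding pressure by (simp add: algebra_simps power2_eq_square)
  also have "\<dots> = lam * m - p * (qm i + pressure x i) + (1 - y) * R"
    unfolding root by simp
  finally have eq: "drift x (i, Infected) + (y - y0) * (\<beta> i i * (y + y0) + (qp i + qm i - \<beta> i i))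
      = lam * m - p * (qm i + pressure x i) + (1 - y) * R" .
  have "0 \<le> lam * m" "lam * m \<le> lam * p"
    using m lam by (auto intro!: mult_left_mono)
  moreover have "0 \<le> p * (qm i + pressure x i)"
    using m pressure_bounds(1)[OF x, of i] qm[of i] by (intro mult_nonneg_nonneg) auto
  moreover have "p * (qm i + pressure x i) \<le> p * (qm i + B)"
    using m pressure_bounds(2)[OF x, of i] by (intro mult_left_mono) auto
  moreover have "0 \<le> (1 - y) * R"
    using R0 bd(2) unfolding y_def by (intro mult_nonneg_nonneg) auto
  moreover have "(1 - y) * R \<le> 1 * (B * p)"
    using R0 R1 bd(1) unfolding y_def by (intro mult_mono) auto
  moreover have "0 \<le> B * p" "0 \<le> qm i * p"
    using m B_nonneg qm[of i] by (auto intro!: mult_nonneg_nonneg)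
  ultimately show ?thesis
    unfolding eq by (simp add: abs_le_iff algebra_simps)
qed

text \<open>
  The squared deviation decays at least at the rate \<open>2 * (qp i + qm i - B)\<close> and is perturbed by a multiple of the
  mass outside strategy \<open>i\<close>, which decays at the rate \<open>lam\<close>; the smaller of the two rates survives.
\<close>

lemma infected_deviation:
  assumes x: "population_path t T x" and s: "s \<in> {t..T}"
  defines "\<mu> \<equiv> min lam (2 * (qp i + qm i - B))"
  shows "(x s (i, Infected) - x_star qp qm \<beta> i)\<^sup>2
    \<le> (1 + 2 * (lam + qm i + 2 * B) * (s - t)) * exp (- \<mu> * (s - t))"
proof -
  define y0 where "y0 = x_star qp qm \<beta> i"
  define C where "C = lam + qm i + 2 * B"
  have C: "0 \<le> C"
    using lam qm[of i] B_nonneg by (simp add: C_def)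
  have y0: "0 < y0" "y0 < 1"
    using x_star_root by (auto simp: y0_def)
  have d: "distribution (x r)" if "r \<in> {t..T}" for r
    using x that by (simp add: population_path_def del: evolution_rhs.simps)
  have dist: "\<bar>x r (i, Infected) - y0\<bar> \<le> 1" if "r \<in> {t..T}" for r
    using distribution_bounds(1,2)[OF d[OF that], of "(i, Infected)"] y0 by auto
  have "(x s (i, Infected) - y0)\<^sup>2 \<le> ((x t (i, Infected) - y0)\<^sup>2 + 2 * C * (s - t)) * exp (- \<mu> * (s - t))"
  proof (rule gronwall_exponential[OF _ _ s])
    fix r assume r: "r \<in> {t..T}"
    define p where "p = 1 - x r (i, Infected) - x r (i, Susceptible)"
    define e where "e = x r (i, Infected) - y0"
    define k where "k = \<beta> i i * (x r (i, Infected) + y0) + (qp i + qm i - \<beta> i i)"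
    have dx: "((\<lambda>r. x r z) has_real_derivative drift (x r) z) (at r within {t..T})" for z
      using x r by (simp add: population_path_def del: evolution_rhs.simps)
    show "((\<lambda>r. (x r (i, Infected) - y0)\<^sup>2) has_real_derivative 2 * (e * drift (x r) (i, Infected))) (at r within {t..T})"
      using DERIV_power[OF DERIV_diff[OF dx[of "(i, Infected)"] DERIV_const[of y0]], of 2]
      by (simp add: e_def mult_ac del: evolution_rhs.simps right_diff_distrib_numeral)
    have p: "0 \<le> p" "p \<le> exp (- lam * (r - t))" "(\<Sum>k\<in>UNIV - {i}. x r (k, Infected)) \<le> p"
      using mass_elsewhere[OF x r] by (simp_all add: p_def)
    have drift: "\<bar>drift (x r) (i, Infected) + e * k\<bar> \<le> C * p"
      using drift_infected_near_root[OF d[OF r]] p(3) by (simp add: p_def e_def k_def C_def y0_def del: evolution_rhs.simps)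
    have "0 \<le> \<beta> i i * (x r (i, Infected) + y0)"
      using \<beta>_nonneg[of i i] y0 distribution_bounds(1)[OF d[OF r], of "(i, Infected)"] by simp
    then have k: "\<mu> \<le> 2 * k"
      using \<beta>_le[of i i] by (simp add: \<mu>_def k_def)
    have "\<mu> * e\<^sup>2 \<le> 2 * k * e\<^sup>2"
      using k by (intro mult_right_mono) auto
    moreover have "e * (drift (x r) (i, Infected) + e * k) \<le> \<bar>e\<bar> * \<bar>drift (x r) (i, Infected) + e * k\<bar>"
      by (metis abs_ge_self abs_mult)
    moreover have "\<bar>e\<bar> * \<bar>drift (x r) (i, Infected) + e * k\<bar> \<le> 1 * (C * p)"
      using drift dist[OF r] by (intro mult_mono) (auto simp: e_def)
    moreover have "C * p \<le> C * exp (- \<mu> * (r - t))"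
    proof -
      have "\<mu> * (r - t) \<le> lam * (r - t)"
        using r by (intro mult_right_mono) (auto simp: \<mu>_def)
      then have "exp (- lam * (r - t)) \<le> exp (- \<mu> * (r - t))" by simp
      then show ?thesis
        using p(2) C by (intro mult_left_mono) linarith+
    qed
    ultimately have "2 * (e * drift (x r) (i, Infected)) \<le> - (\<mu> * e\<^sup>2) + 2 * C * exp (- \<mu> * (r - t))"
      by (simp add: algebra_simps power2_eq_square del: evolution_rhs.simps)
    then show "2 * (e * drift (x r) (i, Infected))
        \<le> - (\<mu> * (x r (i, Infected) - y0)\<^sup>2) + 2 * C * exp (- \<mu> * (r - t))"
      by (simp add: e_def del: evolution_rhs.simps)
  qed
  also have "\<dots> \<le> (1 + 2 * C * (s - t)) * exp (- \<mu> * (s - t))"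
    using dist[of t] s abs_square_le_1 by (intro mult_right_mono) auto
  finally show ?thesis
    by (simp add: C_def y0_def)
qed

lemma population_converges:
  assumes "0 < \<epsilon>"
  obtains L where "0 \<le> L" "\<And>t T x s z. population_path t T x \<Longrightarrow> s \<in> {t + L..T} \<Longrightarrow>
    \<bar>x s z - x_bar qp qm \<beta> i z\<bar> < \<epsilon>"
proof -
  define C where "C = 2 * (lam + qm i + 2 * B)"
  define \<mu> where "\<mu> = min lam (2 * (qp i + qm i - B))"
  have \<mu>: "0 < \<mu>"
    using lam B_lt by (simp add: \<mu>_def)
  have "((\<lambda>s. (1 + C * s) * exp (- \<mu> * s)) \<longlongrightarrow> 0) at_top"
    using \<mu> by real_asymp
  moreover have "((\<lambda>s. exp (- lam * s)) \<longlongrightarrow> 0) at_top"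
    using lam by real_asymp
  ultimately have "\<forall>\<^sub>F s in at_top. (1 + C * s) * exp (- \<mu> * s) < (\<epsilon> / 2)\<^sup>2 \<and> exp (- lam * s) < \<epsilon> / 2"
    using assms by (intro eventually_conj; elim order_tendstoD) auto
  then obtain L0 where L0: "\<And>s. L0 \<le> s \<Longrightarrow> (1 + C * s) * exp (- \<mu> * s) < (\<epsilon> / 2)\<^sup>2 \<and> exp (- lam * s) < \<epsilon> / 2"
    by (auto simp: eventually_at_top_linorder)
  show ?thesis
  proof (rule that[of "max 0 L0"])
    fix t T x s z assume x: "population_path t T x" and "s \<in> {t + max 0 L0..T}"
    then have s: "s \<in> {t..T}" and L: "L0 \<le> s - t" by auto
    define p where "p = 1 - x s (i, Infected) - x s (i, Susceptible)"
    have p: "0 \<le> p" "p < \<epsilon> / 2" "\<And>j m. j \<noteq> i \<Longrightarrow> x s (j, m) \<le> p"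
      using mass_elsewhere[OF x s] L0[OF L] by (auto simp: p_def)
    have "(x s (i, Infected) - x_star qp qm \<beta> i)\<^sup>2 < (\<epsilon> / 2)\<^sup>2"
      using infected_deviation[OF x s] L0[OF L] by (simp add: C_def \<mu>_def)
    then have e: "\<bar>x s (i, Infected) - x_star qp qm \<beta> i\<bar> < \<epsilon> / 2"
      using assms power2_less_imp_less[of "\<bar>x s (i, Infected) - x_star qp qm \<beta> i\<bar>" "\<epsilon> / 2"] by simp
    have nn: "0 \<le> x s z"
      using x s by (auto simp: population_path_def simp del: evolution_rhs.simps intro: distribution_bounds(1))
    obtain j m where z: "z = (j, m)" by (cases z)
    show "\<bar>x s z - x_bar qp qm \<beta> i z\<bar> < \<epsilon>"
    proof (cases "j = i")
      case True
      have "\<bar>x s (i, Susceptible) - (1 - x_star qp qm \<beta> i)\<bar> < \<epsilon>"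
        using e p(1,2) unfolding p_def by linarith
      then show ?thesis
        using True e assms unfolding z by (cases m) (simp_all add: x_bar_def)
    next
      case False
      then show ?thesis
        using p(2) p(3)[OF False, of m] nn assms unfolding z by (auto simp: x_bar_def)
    qed
  qed simp
qed

section \<open>Payoffs\<close>

lemma jump_rate_bounds:
  assumes "\<And>j. 0 \<le> b j" "\<And>j. b j \<le> B"
  shows "0 \<le> jump_rate b z z'" "jump_rate b z z' \<le> lam + (\<Sum>j\<in>UNIV. qp j + qm j) + B"
proof -
  note q = rates_le_sum
  obtain j m where z: "z = (j, m)" by (cases z)
  have "0 \<le> jump_rate b z z' \<and> jump_rate b z z' \<le> lam + (qp j + qm j) + B"
    using assms[of j] lam qp[of j] qm[of j] B_nonneg unfolding z
    by (cases m) (auto simp: of_bool_def)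
  then show "0 \<le> jump_rate b z z'" "jump_rate b z z' \<le> lam + (\<Sum>j\<in>UNIV. qp j + qm j) + B"
    using q[of j] by auto
qed

text \<open>
  Two payoffs under possibly different pressures: their difference solves the equation of the chain
  with the pressures \<open>b1\<close>, and the pressures disagree only in the infection term of \<open>g2\<close>, which gives
  the running error. Equal pressures (\<open>\<rho> = 0\<close>) give uniqueness, a stationary \<open>g2\<close> gives the long-time
  behaviour.
\<close>

lemma payoff_difference:
  assumes g1: "payoff_path t T b1 g1" and g2: "payoff_path t T b2 g2" and "t \<le> p"
    and b1: "\<And>s j. s \<in> {p..T} \<Longrightarrow> 0 \<le> b1 s j" "\<And>s j. s \<in> {p..T} \<Longrightarrow> b1 s j \<le> B"
    and close: "\<And>s j. s \<in> {p..T} \<Longrightarrow>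
      \<bar>b1 s j - b2 s j\<bar> * \<bar>g2 s (j, Infected) - g2 s (j, Susceptible)\<bar> \<le> \<rho>"
    and final: "\<And>z. \<bar>g1 T z - g2 T z\<bar> \<le> V"
    and s: "s \<in> {p..T}"
  shows "\<bar>g1 s z - g2 s z\<bar> \<le> V * exp (- \<delta> * (T - s)) + \<rho> / \<delta>"
proof (rule discounted_maximum_principle[where e = "\<lambda>s z. g1 s z - g2 s z" and Q = "\<lambda>s. jump_rate (b1 s)"
      and e' = "\<lambda>s z. payoff_slope (b1 s) (g1 s) z - payoff_slope (b2 s) (g2 s) z", OF \<delta> _ _ _ final s])
  fix r z assume r: "r \<in> {p..T}"
  have "((\<lambda>r. g1 r z - g2 r z) has_real_derivative
      payoff_slope (b1 r) (g1 r) z - payoff_slope (b2 r) (g2 r) z) (at r within {t..T})"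
    using g1 g2 r \<open>t \<le> p\<close> by (intro DERIV_diff) (auto simp: payoff_path_def)
  then show "((\<lambda>r. g1 r z - g2 r z) has_real_derivative
      payoff_slope (b1 r) (g1 r) z - payoff_slope (b2 r) (g2 r) z) (at r within {p..T})"
    by (rule DERIV_subset) (use \<open>t \<le> p\<close> in auto)
  have "0 \<le> \<rho>"
    using close[OF r] order_trans[OF mult_nonneg_nonneg[OF abs_ge_zero abs_ge_zero]] by blast
  obtain j m where z: "z = (j, m)" by (cases z)
  have "payoff_slope (b1 r) (g1 r) z - payoff_slope (b1 r) (g2 r) z = \<delta> * (g1 r z - g2 r z)
      - (\<Sum>z'\<in>UNIV. jump_rate (b1 r) z z' * (g1 r z' - g2 r z' - (g1 r z - g2 r z)))"
    by (simp add: payoff_slope_def algebra_simps sum_subtractf sum.distrib)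
  moreover have "\<bar>payoff_slope (b1 r) (g2 r) z - payoff_slope (b2 r) (g2 r) z\<bar> \<le> \<rho>"
  proof (cases m)
    case Infected
    then show ?thesis using \<open>0 \<le> \<rho>\<close> by (simp add: z payoff_slope_simps)
  next
    case Susceptible
    have "payoff_slope (b1 r) (g2 r) z - payoff_slope (b2 r) (g2 r) z
        = - ((b1 r j - b2 r j) * (g2 r (j, Infected) - g2 r (j, Susceptible)))"
      by (simp add: z Susceptible payoff_slope_simps algebra_simps)
    then show ?thesis using close[OF r, of j] by (simp add: abs_mult)
  qed
  ultimately show "\<bar>payoff_slope (b1 r) (g1 r) z - payoff_slope (b2 r) (g2 r) z -
      (\<delta> * (g1 r z - g2 r z)
      - (\<Sum>z'\<in>UNIV. jump_rate (b1 r) z z' * (g1 r z' - g2 r z' - (g1 r z - g2 r z))))\<bar> \<le> \<rho>"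
    by linarith
  fix z'
  show "0 \<le> jump_rate (b1 r) z z' \<and> jump_rate (b1 r) z z' \<le> lam + (\<Sum>j\<in>UNIV. qp j + qm j) + B"
    using jump_rate_bounds[of "b1 r" z z'] b1[OF r] by blast
qed

text \<open>
  In the variables \<open>gap j = g (j, Infected) - g (j, Susceptible)\<close> and \<open>G j = g (j, Infected)\<close> the linear
  system is triangular: the gaps solve a system of their own, and \<open>G\<close> is driven by them. Both systems are
  coupled through component \<open>i\<close> only.
\<close>

lemma payoff_path_exists:
  assumes b: "\<And>j. continuous_on {t..T} (\<lambda>s. b s j)"
  obtains g where "g T = gT" "payoff_path t T b g"
proof -
  have "\<exists>y. (\<forall>j. y T j = gT (j, Infected) - gT (j, Susceptible)) \<and>
    (\<forall>s\<in>{t..T}. \<forall>j. ((\<lambda>s. y s j) has_real_derivative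
        (\<delta> + qp j + qm j + b s j) * y s j - lam * (y s i - y s j)
          + (w (j, Susceptible) - w (j, Infected))) (at s within {t..T}))"
    by (rule star_coupled_linear_ode_backward) (intro continuous_intros b)+
  then obtain gap where gap: "\<And>j. gap T j = gT (j, Infected) - gT (j, Susceptible)"
    and dgap: "\<And>s j. s \<in> {t..T} \<Longrightarrow> ((\<lambda>s. gap s j) has_real_derivative
        (\<delta> + qp j + qm j + b s j) * gap s j - lam * (gap s i - gap s j)
          + (w (j, Susceptible) - w (j, Infected))) (at s within {t..T})"
    by blast
  have gap_cont: "continuous_on {t..T} (\<lambda>s. gap s j)" for j
    using dgap by (rule DERIV_continuous_on)
  have "\<exists>y. (\<forall>j. y T j = gT (j, Infected)) \<and>
    (\<forall>s\<in>{t..T}. \<forall>j. ((\<lambda>s. y s j) has_real_derivative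
        \<delta> * y s j - lam * (y s i - y s j) + (qp j * gap s j - w (j, Infected))) (at s within {t..T}))"
    by (rule star_coupled_linear_ode_backward) (intro continuous_intros gap_cont)+
  then obtain G where G: "\<And>j. G T j = gT (j, Infected)"
    and dG: "\<And>s j. s \<in> {t..T} \<Longrightarrow> ((\<lambda>s. G s j) has_real_derivative
        \<delta> * G s j - lam * (G s i - G s j) + (qp j * gap s j - w (j, Infected))) (at s within {t..T})"
    by blast
  define g where "g = (\<lambda>s (j, m). case m of Infected \<Rightarrow> G s j | Susceptible \<Rightarrow> G s j - gap s j)"
  show ?thesis
  proof (rule that[of g])
    show "g T = gT"
    proof
      fix z :: "'d state" show "g T z = gT z"
        using G gap by (cases z; cases "snd z") (auto simp: g_def)
    qed
    show "payoff_path t T b g"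
      unfolding payoff_path_def
    proof (intro ballI allI)
      fix s and z :: "'d state" assume s: "s \<in> {t..T}"
      obtain j m where z: "z = (j, m)" by (cases z)
      show "((\<lambda>r. g r z) has_real_derivative payoff_slope (b s) (g s) z) (at s within {t..T})"
      proof (cases m)
        case Infected
        then show ?thesis
          using dG[OF s, of j] by (simp add: z g_def payoff_slope_simps algebra_simps)
      next
        case Susceptible
        have "payoff_slope (b s) (g s) (j, Susceptible) =
            \<delta> * G s j - lam * (G s i - G s j) + (qp j * gap s j - w (j, Infected))
            - ((\<delta> + qp j + qm j + b s j) * gap s j - lam * (gap s i - gap s j)
          + (w (j, Susceptible) - w (j, Infected)))"
          by (simp add: g_def payoff_slope_simps algebra_simps)
        then show ?thesis
          using DERIV_diff[OF dG[OF s, of j] dgap[OF s, of j]] by (simp add: z Susceptible g_def)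
      qed
    qed
  qed
qed

lemma payoff_slope_gap:
  "payoff_slope b g (i, Infected) - payoff_slope b g (i, Susceptible)
    = (\<delta> + qp i + qm i + b i) * (g (i, Infected) - g (i, Susceptible))
      - (qm i + qp i + \<delta>) * gap_bound"
proof -
  have "(qm i + qp i + \<delta>) * gap_bound = w (i, Infected) - w (i, Susceptible)"
    using qm[of i] qp[of i] \<delta> by (simp add: gap_bound_def)
  then show ?thesis
    by (simp add: payoff_slope_simps algebra_simps)
qed

text \<open>
  The differences of the two sides are the source terms of the advantages, here shown to be
  nonnegative. Both are affine in the gap of strategy \<open>i\<close>, and as \<open>qp i \<le> qp j\<close> and \<open>qm j \<le> qm i\<close>, the worst
  case is a gap equal to \<open>gap_bound\<close>, which the cost conditions cover.
\<close>

lemma payoff_slope_advantage: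
  fixes g :: "'d state \<Rightarrow> real"
  assumes "j \<noteq> i" and gap: "0 \<le> g (i, Infected) - g (i, Susceptible)"
      "g (i, Infected) - g (i, Susceptible) \<le> gap_bound"
    and b: "0 \<le> b j" "b i \<le> B"
  defines "a \<equiv> \<lambda>m. g (j, m) - g (i, m)"
  shows "payoff_slope b g (j, Infected) - payoff_slope b g (i, Infected)
      \<le> (\<delta> + lam + qp j) * a Infected - qp j * a Susceptible"
    and "payoff_slope b g (j, Susceptible) - payoff_slope b g (i, Susceptible)
      \<le> (\<delta> + lam + qm j + b j) * a Susceptible - (qm j + b j) * a Infected"
proof -
  define \<Delta> where "\<Delta> = g (i, Infected) - g (i, Susceptible)"
  have "(qp j - qp i) * \<Delta> \<le> (qp j - qp i) * gap_bound"
    using gap qp_i_le[of j] by (intro mult_left_mono) (auto simp: \<Delta>_def)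
  moreover have "payoff_slope b g (j, Infected) - payoff_slope b g (i, Infected)
      = (\<delta> + lam + qp j) * a Infected - qp j * a Susceptible + ((qp j - qp i) * \<Delta> - (w (j, Infected) - w (i, Infected)))"
    by (simp add: payoff_slope_simps a_def \<Delta>_def algebra_simps)
  ultimately show "payoff_slope b g (j, Infected) - payoff_slope b g (i, Infected)
      \<le> (\<delta> + lam + qp j) * a Infected - qp j * a Susceptible"
    using infected_cost[OF \<open>j \<noteq> i\<close>] by (simp add: gap_bound_def)
  have "(qm i - qm j + b i - b j) * \<Delta> \<le> (qm i - qm j + B) * \<Delta>"
    using b gap by (intro mult_right_mono) (auto simp: \<Delta>_def)
  also have "\<dots> \<le> (qm i - qm j + B) * gap_bound"
    using gap qm_le_i[of j] B_nonneg by (intro mult_left_mono) (auto simp: \<Delta>_def)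
  finally have "(qm i - qm j + b i - b j) * \<Delta> \<le> (qm i - qm j + B) * gap_bound" .
  moreover have "payoff_slope b g (j, Susceptible) - payoff_slope b g (i, Susceptible)
      = (\<delta> + lam + qm j + b j) * a Susceptible - (qm j + b j) * a Infected
      + ((qm i - qm j + b i - b j) * \<Delta> - (w (j, Susceptible) - w (i, Susceptible)))"
    by (simp add: payoff_slope_simps a_def \<Delta>_def algebra_simps)
  ultimately show "payoff_slope b g (j, Susceptible) - payoff_slope b g (i, Susceptible)
      \<le> (\<delta> + lam + qm j + b j) * a Susceptible - (qm j + b j) * a Infected"
    using susceptible_cost[OF \<open>j \<noteq> i\<close>] by (simp add: gap_bound_def)
qed

text \<open>
  Both bounds are instances of positivity for a single component, hence the index type \<^typ>\<open>unit\<close>.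
  A higher pressure only pulls the gap down.
\<close>

lemma own_gap_bounds:
  assumes g: "payoff_path t T b g"
    and b: "\<And>s. s \<in> {t..T} \<Longrightarrow> 0 \<le> b s i" "\<And>s. s \<in> {t..T} \<Longrightarrow> b s i \<le> B"
    and final: "0 \<le> g T (i, Infected) - g T (i, Susceptible)" "g T (i, Infected) - g T (i, Susceptible) \<le> gap_bound"
    and s: "s \<in> {t..T}"
  shows "0 \<le> g s (i, Infected) - g s (i, Susceptible)" "g s (i, Infected) - g s (i, Susceptible) \<le> gap_bound"
proof -
  define \<Delta> where "\<Delta> = (\<lambda>s. g s (i, Infected) - g s (i, Susceptible))"
  define c where "c = (\<lambda>s (_::unit). \<delta> + qp i + qm i + b s i)"
  define K where "K = \<delta> + qp i + qm i + B"
  have d\<Delta>: "(\<Delta> has_real_derivative c r () * \<Delta> r - (qm i + qp i + \<delta>) * gap_bound) (at r within {t..T})"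
    if r: "r \<in> {t..T}" for r
  proof -
    have "(\<Delta> has_real_derivative payoff_slope (b r) (g r) (i, Infected) - payoff_slope (b r) (g r) (i, Susceptible))
        (at r within {t..T})"
      unfolding \<Delta>_def using g r by (intro DERIV_diff) (auto simp: payoff_path_def)
    then show ?thesis
      by (simp add: payoff_slope_gap \<Delta>_def c_def)
  qed
  have cK: "\<bar>c r u\<bar> \<le> K" and c0: "qm i + qp i + \<delta> \<le> c r u" if "r \<in> {t..T}" for r u
    using b[OF that] \<delta> qp[of i] qm[of i] by (auto simp: c_def K_def)
  have K: "0 \<le> K"
    using cK[OF s] abs_ge_zero order_trans by blast
  have gb: "0 \<le> (qm i + qp i + \<delta>) * gap_bound"
    using gap_bound_pos \<delta> qp[of i] qm[of i] by simp
  have "0 \<le> (\<lambda>s (_::unit). \<Delta> s) s ()"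
    by (rule backward_positivity[where c = c and Q = "\<lambda>_ _ _. 0" and K = K, OF d\<Delta> _ _ cK _ s])
      (use K gb final in \<open>auto simp: \<Delta>_def\<close>)
  then show "0 \<le> g s (i, Infected) - g s (i, Susceptible)"
    by (simp add: \<Delta>_def)
  have "0 \<le> (\<lambda>s (_::unit). gap_bound - \<Delta> s) s ()"
  proof (rule backward_positivity[where c = c and Q = "\<lambda>_ _ _. 0" and K = K, OF DERIV_diff[OF DERIV_const d\<Delta>] _ _ cK _ s])
    fix r and u :: unit assume r: "r \<in> {t..T}"
    have "(qm i + qp i + \<delta>) * gap_bound \<le> c r u * gap_bound"
      using c0[OF r] gap_bound_pos by (intro mult_right_mono) auto
    then show "0 - (c r () * \<Delta> r - (qm i + qp i + \<delta>) * gap_bound)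
        \<le> c r u * (gap_bound - \<Delta> r) - (\<Sum>z'\<in>(UNIV::unit set). 0 * (gap_bound - \<Delta> r))"
      by (simp add: algebra_simps)
  qed (use K final in \<open>auto simp: \<Delta>_def\<close>)
  then show "g s (i, Infected) - g s (i, Susceptible) \<le> gap_bound"
    by (simp add: \<Delta>_def)
qed

text \<open>
  The advantages of \<open>i\<close> over \<open>j\<close> in the two statuses form a cooperative system of two components.
\<close>

lemma payoff_order:
  assumes g: "payoff_path t T b g"
    and b: "\<And>s j. s \<in> {t..T} \<Longrightarrow> 0 \<le> b s j" "\<And>s j. s \<in> {t..T} \<Longrightarrow> b s j \<le> B"
    and final: "admissible_terminal i gap_bound (g T)"
    and s: "s \<in> {t..T}"
  shows "g s (i, m) \<le> g s (j, m)"
proof (cases "j = i")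
  case False
  have gap: "0 \<le> g r (i, Infected) - g r (i, Susceptible)" "g r (i, Infected) - g r (i, Susceptible) \<le> gap_bound"
    if "r \<in> {t..T}" for r
    using own_gap_bounds[OF g b _ _ that] final by (auto simp: admissible_terminal_def)
  define a where "a = (\<lambda>s m. g s (j, m) - g s (i, m))"
  define a' where "a' = (\<lambda>s m. payoff_slope (b s) (g s) (j, m) - payoff_slope (b s) (g s) (i, m))"
  define Q where "Q = (\<lambda>s m m'. if m = m' then 0 else case m of Infected \<Rightarrow> qp j | Susceptible \<Rightarrow> qm j + b s j)"
  define c where "c = (\<lambda>s m. \<delta> + lam + (case m of Infected \<Rightarrow> qp j | Susceptible \<Rightarrow> qm j + b s j))"
  have "0 \<le> a s m"
  proof (rule backward_positivity[where c = c and Q = Q and K = "\<delta> + lam + qp j + qm j + B" and u' = a', OF _ _ _ _ _ s])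
    fix r m assume r: "r \<in> {t..T}"
    show "((\<lambda>r. a r m) has_real_derivative a' r m) (at r within {t..T})"
      unfolding a_def a'_def using g r by (intro DERIV_diff) (auto simp: payoff_path_def)
    have adv: "a' r Infected \<le> (\<delta> + lam + qp j) * a r Infected - qp j * a r Susceptible"
      "a' r Susceptible \<le> (\<delta> + lam + qm j + b r j) * a r Susceptible - (qm j + b r j) * a r Infected"
      using payoff_slope_advantage[OF False gap[OF r] b[OF r]] by (simp_all add: a_def a'_def)
    then show "a' r m \<le> c r m * a r m - (\<Sum>m'\<in>UNIV. Q r m m' * a r m')"
      by (cases m) (simp_all add: sum_status c_def Q_def add.assoc)
    show "\<bar>c r m\<bar> \<le> \<delta> + lam + qp j + qm j + B"
      using b[OF r, of j] \<delta> lam qp[of j] qm[of j] B_nonneg by (cases m) (auto simp: c_def)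
    show "0 \<le> Q r m m' \<and> Q r m m' \<le> \<delta> + lam + qp j + qm j + B" for m'
      using b[OF r, of j] \<delta> lam qp[of j] qm[of j] B_nonneg by (cases m) (auto simp: Q_def)
  next
    show "0 \<le> a T m" for m
      using final False by (cases m) (auto simp: admissible_terminal_def a_def)
  qed
  then show ?thesis by (simp add: a_def)
qed simp

text \<open>
  The equations are triangular in the gaps and the values in the infected states, as in the
  time-dependent case. For the order, the smaller of the two advantages of \<open>i\<close> over \<open>j\<close> can only be
  increased by the coupling with the other one, so its nonnegative source makes it nonnegative.
\<close>

lemma stationary_payoff_exists:
  assumes b: "\<And>j. 0 \<le> b j" "\<And>j. b j \<le> B"
  shows "\<exists>g. (\<forall>z. payoff_slope b g z = 0) \<and> (\<forall>j m. g (i, m) \<le> g (j, m))"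
proof -
  have star: "\<exists>y. \<forall>j. a j * y j - lam * (y i - y j) = r j" if a: "\<And>j. 0 < a j" for a r :: "'d \<Rightarrow> real"
  proof
    define y where "y = (\<lambda>j. (r j + lam * (r i / a i)) / (a j + lam))"
    have pos: "0 < a j + lam" for j
      using a[of j] lam by simp
    have "r i + lam * (r i / a i) = r i / a i * (a i + lam)"
      using a[of i] by (simp add: field_simps)
    then have "y i = r i / a i"
      using a[of i] lam by (simp add: y_def)
    then have "(a j + lam) * y j = r j + lam * y i" for j
      using pos[of j] by (simp add: y_def)
    then show "\<forall>j. a j * y j - lam * (y i - y j) = r j"
      by (simp add: algebra_simps)
  qed
  have "0 < \<delta> + qp j + qm j + b j" for j
    using \<delta> qp[of j] qm[of j] b(1)[of j] by simp
  from star[of "\<lambda>j. \<delta> + qp j + qm j + b j" "\<lambda>j. w (j, Infected) - w (j, Susceptible)", OF this]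
  obtain gap where gap: "\<forall>j. (\<delta> + qp j + qm j + b j) * gap j - lam * (gap i - gap j) = w (j, Infected) - w (j, Susceptible)"
    by (rule exE)
  from star[of "\<lambda>_. \<delta>" "\<lambda>j. w (j, Infected) - qp j * gap j", OF \<delta>]
  obtain G where G: "\<forall>j. \<delta> * G j - lam * (G i - G j) = w (j, Infected) - qp j * gap j"
    by (rule exE)
  define g where "g = (\<lambda>(j, m). case m of Infected \<Rightarrow> G j | Susceptible \<Rightarrow> G j - gap j)"
  have zero: "payoff_slope b g z = 0" for z
  proof -
    obtain j m where z: "z = (j, m)" by (cases z)
    show ?thesis
      using G[rule_format, of j] gap[rule_format, of j] unfolding z by (cases m) (simp_all add: g_def payoff_slope_simps algebra_simps)
  qed
  define k where "k = \<delta> + qp i + qm i + b i"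
  have k: "0 < k" "qm i + qp i + \<delta> \<le> k"
    using \<delta> qp[of i] qm[of i] b(1)[of i] by (auto simp: k_def)
  have kgap: "k * (g (i, Infected) - g (i, Susceptible)) = (qm i + qp i + \<delta>) * gap_bound"
    using payoff_slope_gap[of b g] by (simp add: zero k_def)
  have "(qm i + qp i + \<delta>) * gap_bound \<le> k * gap_bound"
    using k gap_bound_pos by (intro mult_right_mono) auto
  then have gap_le: "g (i, Infected) - g (i, Susceptible) \<le> gap_bound"
    using k kgap by (metis mult_le_cancel_left_pos)
  have "0 \<le> k * (g (i, Infected) - g (i, Susceptible))"
    unfolding kgap using gap_bound_pos \<delta> qp[of i] qm[of i] by simp
  then have gap_ge: "0 \<le> g (i, Infected) - g (i, Susceptible)"
    using k by (simp add: zero_le_mult_iff)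
  have "g (i, m) \<le> g (j, m)" for j m
  proof (cases "j = i")
    case False
    define a where "a = (\<lambda>m. g (j, m) - g (i, m))"
    have adv: "0 \<le> (\<delta> + lam + qp j) * a Infected - qp j * a Susceptible"
      "0 \<le> (\<delta> + lam + qm j + b j) * a Susceptible - (qm j + b j) * a Infected"
      using payoff_slope_advantage[where b = b, OF False gap_ge gap_le b] by (simp_all add: a_def zero)
    have least: "0 \<le> y" if "y \<le> y'" "0 \<le> (\<delta> + lam + q) * y - q * y'" "0 \<le> q" for y y' q
    proof -
      have "0 \<le> q * (y' - y)" using that by simp
      then have "0 \<le> (\<delta> + lam) * y" using that by (simp add: algebra_simps)
      then show ?thesis using \<delta> lam by (simp add: zero_le_mult_iff)
    qed
    have "0 \<le> a Infected \<and> 0 \<le> a Susceptible"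
      using least[of "a Infected" "a Susceptible" "qp j"] least[of "a Susceptible" "a Infected" "qm j + b j"]
        adv qp[of j] qm[of j] b(1)[of j] by (cases "a Infected \<le> a Susceptible") (auto simp: add.assoc)
    then show ?thesis by (cases m) (auto simp: a_def)
  qed simp
  then show ?thesis using zero by blast
qed

text \<open>
  Constant payoffs are payoff paths on \<^term>\<open>{0..1::real}\<close>, so discounting shrinks their largest difference by the
  factor \<open>exp (- \<delta>)\<close>, although it is constant.
\<close>

lemma stationary_payoff_unique:
  assumes b: "\<And>j. 0 \<le> b j" "\<And>j. b j \<le> B"
    and g1: "\<And>z. payoff_slope b g1 z = 0" and g2: "\<And>z. payoff_slope b g2 z = 0"
  shows "g1 = g2"
proof -
  have const: "payoff_path 0 1 (\<lambda>_. b) (\<lambda>_. g)" if "\<And>z. payoff_slope b g z = 0" for g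
    using that by (simp add: payoff_path_def)
  define V where "V = Max (range (\<lambda>z. \<bar>g1 z - g2 z\<bar>))"
  have V: "\<bar>g1 z - g2 z\<bar> \<le> V" for z
    unfolding V_def by (intro Max_ge) auto
  have "V \<in> range (\<lambda>z. \<bar>g1 z - g2 z\<bar>)"
    unfolding V_def by (intro Max_in) auto
  then obtain z0 where z0: "V = \<bar>g1 z0 - g2 z0\<bar>" by blast
  have "\<bar>g1 z0 - g2 z0\<bar> \<le> V * exp (- \<delta> * (1 - 0)) + 0 / \<delta>"
    by (rule payoff_difference[OF const[OF g1] const[OF g2], where p = 0]) (use b V in auto)
  then have "0 \<le> V * (exp (- \<delta>) - 1)"
    using z0 by (simp add: algebra_simps)
  then have "V \<le> 0"
    using \<delta> by (simp add: zero_le_mult_iff)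
  then show ?thesis
    using V by (metis abs_le_zero_iff eq_iff_diff_eq_0 ext order_trans)
qed

lemma g_bar_stationary: "payoff_slope (pressure (x_bar qp qm \<beta> i)) (g_bar lam qp qm w \<delta> \<beta> i) z = 0"
proof -
  let ?b = "pressure (x_bar qp qm \<beta> i)"
  let ?P = "\<lambda>g. (\<forall>z. hjb_lhs lam qp qm w \<beta> (x_bar qp qm \<beta> i) g z = \<delta> * g z) \<and> minimizing (u_hat i) g"
  have b: "0 \<le> ?b j" "?b j \<le> B" for j
    by (rule pressure_bounds[OF distribution_x_bar])+
  have iff: "?P g \<longleftrightarrow> (\<forall>z. payoff_slope ?b g z = 0) \<and> minimizing (u_hat i) g" for g
    using hjb_iff_payoff_slope[where d = 0 and x = "x_bar qp qm \<beta> i" and g = g] by auto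
  obtain g where g: "\<And>z. payoff_slope ?b g z = 0" "\<And>j m. g (i, m) \<le> g (j, m)"
    using stationary_payoff_exists[of ?b, OF b] by blast
  have "?P g"
    unfolding iff unfolding minimizing_u_hat_iff using g by (intro conjI allI)
  moreover have "g' = g" if "?P g'" for g'
    using that unfolding iff by (intro stationary_payoff_unique[of ?b, OF b _ g(1)]) auto
  ultimately have "g_bar lam qp qm w \<delta> \<beta> i = g"
    unfolding g_bar_def by (intro the_equality)
  then show ?thesis
    using g(1) by simp
qed

lemma pressure_continuous:
  assumes "population_path t T x"
  shows "continuous_on {t..T} (\<lambda>s. pressure (x s) j)"
proof -
  have "continuous_on {t..T} (\<lambda>s. x s z)" for z
    using assms by (intro DERIV_continuous_on) (auto simp: population_path_def simp del: evolution_rhs.simps)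
  then show ?thesis
    unfolding pressure_def by (intro continuous_intros)
qed

lemma path_pressure_bounds:
  assumes "population_path t T x" "s \<in> {t..T}"
  shows "0 \<le> pressure (x s) j" "pressure (x s) j \<le> B"
  using pressure_bounds[of "x s"] assms by (auto simp: population_path_def simp del: evolution_rhs.simps)

text \<open>
  After the time \<open>L\<close> the population, and with it the pressure, is so close to its limit that the
  running error contributes at most \<open>\<epsilon> / 2\<close>, whatever the terminal payoff. The terminal error is
  discounted to less than \<open>\<epsilon> / 2\<close> at a distance \<open>L'\<close> from the final time that depends on its size.
\<close>

lemma payoff_turnpike:
  assumes "0 < \<epsilon>"
  obtains L where "0 \<le> L" "\<And>gT. \<exists>L'\<ge>0. \<forall>t T x g. population_path t T x \<longrightarrow>
    payoff_path t T (\<lambda>s. pressure (x s)) g \<longrightarrow> g T = gT \<longrightarrow>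
    (\<forall>s\<in>{t + L..T - L'}. \<forall>z. \<bar>g s z - g_bar lam qp qm w \<delta> \<beta> i z\<bar> < \<epsilon>)"
proof -
  let ?g = "g_bar lam qp qm w \<delta> \<beta> i" and ?x = "x_bar qp qm \<beta> i"
  define D where "D = (\<Sum>j\<in>UNIV. \<bar>?g (j, Infected) - ?g (j, Susceptible)\<bar>)"
  define \<rho> where "\<rho> = \<epsilon> * \<delta> / 2"
  define c where "c = real CARD('d) * B * D"
  have D: "\<bar>?g (j, Infected) - ?g (j, Susceptible)\<bar> \<le> D" for j
    unfolding D_def by (rule member_le_sum) auto
  have D0: "0 \<le> D"
    unfolding D_def by (intro sum_nonneg) auto
  have c: "0 \<le> c"
    using D0 B_nonneg by (simp add: c_def)
  have \<rho>: "0 < \<rho>"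
    using assms \<delta> by (simp add: \<rho>_def)
  \<comment> \<open>The summand 1 is there because \<open>c\<close> vanishes if \<open>B\<close> does.\<close>
  define \<epsilon>' where "\<epsilon>' = \<rho> / (c + 1)"
  have \<epsilon>': "0 < \<epsilon>'" "c * \<epsilon>' \<le> \<rho>"
    using \<rho> c by (auto simp: \<epsilon>'_def field_simps)
  obtain L where L: "0 \<le> L" "\<And>t T x s z. population_path t T x \<Longrightarrow> s \<in> {t + L..T} \<Longrightarrow>
    \<bar>x s z - ?x z\<bar> < \<epsilon>'"
    using population_converges[OF \<epsilon>'(1)] by blast
  show ?thesis
  proof (rule that[OF L(1)])
    fix gT :: "'d state \<Rightarrow> real"
    define V where "V = (\<Sum>z\<in>UNIV. \<bar>gT z - ?g z\<bar>)"
    have V: "\<bar>gT z - ?g z\<bar> \<le> V" for z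
      unfolding V_def by (rule member_le_sum) auto
    have "((\<lambda>s. V * exp (- \<delta> * s)) \<longlongrightarrow> 0) at_top"
      using \<delta> by real_asymp
    then have "\<forall>\<^sub>F s in at_top. V * exp (- \<delta> * s) < \<epsilon> / 2"
      using assms by (elim order_tendstoD) auto
    then obtain L0 where L0: "\<And>s. L0 \<le> s \<Longrightarrow> V * exp (- \<delta> * s) < \<epsilon> / 2"
      by (auto simp: eventually_at_top_linorder)
    show "\<exists>L'\<ge>0. \<forall>t T x g. population_path t T x \<longrightarrow>
      payoff_path t T (\<lambda>s. pressure (x s)) g \<longrightarrow> g T = gT \<longrightarrow>
      (\<forall>s\<in>{t + L..T - L'}. \<forall>z. \<bar>g s z - ?g z\<bar> < \<epsilon>)"
    proof (intro exI[of _ "max 0 L0"] conjI allI impI ballI)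
      fix t T x g s z
      assume x: "population_path t T x" and g: "payoff_path t T (\<lambda>s. pressure (x s)) g" and gT: "g T = gT"
        and "s \<in> {t + L..T - max 0 L0}"
      then have s: "s \<in> {t + L..T}" "L0 \<le> T - s" by auto
      have const: "payoff_path t T (\<lambda>_. pressure ?x) (\<lambda>_. ?g)"
        by (simp add: payoff_path_def g_bar_stationary)
      have "\<bar>g s z - ?g z\<bar> \<le> V * exp (- \<delta> * (T - s)) + \<rho> / \<delta>"
      proof (rule payoff_difference[OF g const, where p = "t + L"])
        fix r j assume r: "r \<in> {t + L..T}"
        then have r': "r \<in> {t..T}" using L(1) by auto
        show "0 \<le> pressure (x r) j" "pressure (x r) j \<le> B"
          using path_pressure_bounds[OF x r'] by auto
        have "\<bar>pressure (x r) j - pressure ?x j\<bar> \<le> real CARD('d) * B * \<epsilon>'"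
          by (rule pressure_diff) (use L(2)[OF x r] less_imp_le in blast)
        then have "\<bar>pressure (x r) j - pressure ?x j\<bar> * \<bar>?g (j, Infected) - ?g (j, Susceptible)\<bar>
            \<le> (real CARD('d) * B * \<epsilon>') * D"
          using D D0 B_nonneg \<epsilon>'(1) by (intro mult_mono) auto
        also have "\<dots> \<le> \<rho>"
          using \<epsilon>'(2) by (simp add: c_def mult_ac)
        finally show "\<bar>pressure (x r) j - pressure ?x j\<bar> * \<bar>?g (j, Infected) - ?g (j, Susceptible)\<bar> \<le> \<rho>" .
      qed (use L(1) s V gT in auto)
      also have "\<dots> < \<epsilon> / 2 + \<rho> / \<delta>"
        using L0[OF s(2)] by simp
      also have "\<dots> = \<epsilon>"
        using \<delta> by (simp add: \<rho>_def)
      finally show "\<bar>g s z - ?g z\<bar> < \<epsilon>" .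
    qed simp
  qed
qed

section \<open>Solutions of the consistency equation\<close>

lemma equilibrium_exists:
  assumes "t < T" "distribution x0" and gT: "admissible_terminal i gap_bound gT"
  obtains x g where "mfg_solution lam qp qm w \<delta> \<beta> t T x0 gT x (\<lambda>_. u_hat i) g"
proof -
  obtain x where x: "x t = x0" "population_path t T x"
    by (rule population_path_exists[OF assms(1,2)])
  obtain g where g: "g T = gT" "payoff_path t T (\<lambda>s. pressure (x s)) g"
    by (rule payoff_path_exists[OF pressure_continuous[OF x(2)]])
  have "g s (i, m) \<le> g s (j, m)" if "s \<in> {t..T}" for s j m
    by (rule payoff_order[OF g(2) path_pressure_bounds[OF x(2)] _ that]) (use gT g(1) in auto)
  then have "mfg_solution lam qp qm w \<delta> \<beta> t T x0 gT x (\<lambda>_. u_hat i) g"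
    by (subst mfg_solution_u_hat_iff) (use x g in auto)
  then show ?thesis by (rule that)
qed

lemma equilibrium_unique:
  assumes "mfg_solution lam qp qm w \<delta> \<beta> t T x0 gT x u g" "\<forall>s\<in>{t..T}. u s = u_hat i"
    and "mfg_solution lam qp qm w \<delta> \<beta> t T x0 gT x' u' g'" "\<forall>s\<in>{t..T}. u' s = u_hat i"
    and s: "s \<in> {t..T}"
  shows "x' s = x s" "g' s = g s"
proof -
  note sol = assms(1)[unfolded mfg_solution_u_hat_iff[OF assms(2)]] assms(3)[unfolded mfg_solution_u_hat_iff[OF assms(4)]]
  have x: "x' r = x r" if "r \<in> {t..T}" for r
    by (rule population_path_unique[OF _ _ _ that]) (use sol in auto)
  then show "x' s = x s" using s by blast
  have "\<bar>g' s z - g s z\<bar> \<le> 0 * exp (- \<delta> * (T - s)) + 0 / \<delta>" for z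
  proof (rule payoff_difference[where p = t, OF _ _ order_refl _ _ _ _ s])
    show "payoff_path t T (\<lambda>s. pressure (x' s)) g'" "payoff_path t T (\<lambda>s. pressure (x s)) g"
      using sol by auto
    show "0 \<le> pressure (x' r) j" "pressure (x' r) j \<le> B" if "r \<in> {t..T}" for r j
      using path_pressure_bounds[of t T x' r] that sol by auto
  qed (use sol x in auto)
  then show "g' s = g s" by (intro ext) simp
qed

end

theorem theorem4p1:
  fixes lam \<delta> :: real
    and qp qm :: "'d::finite \<Rightarrow> real"
    and w :: "'d state \<Rightarrow> real"
    and i :: 'd
  assumes "\<delta> > 0" and "lam > 0"
    and "\<And>j. qp j > 0" and "\<And>j. qm j > 0"
    and "\<And>j. w (j, Susceptible) < w (j, Infected)"
    and "\<And>j. j \<noteq> i \<Longrightarrow>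
           (w (j, Infected) - w (i, Infected)) / (w (i, Infected) - w (i, Susceptible))
             > (qp j - qp i) / (qm i + qp i + \<delta>)"
    and "\<And>j. j \<noteq> i \<Longrightarrow>
           (w (j, Susceptible) - w (i, Susceptible)) / (w (i, Infected) - w (i, Susceptible))
             > (qm i - qm j) / (qm i + qp i + \<delta>)"
    and "\<And>j. j \<noteq> i \<Longrightarrow> qp j > qp i"
    and "\<And>j. j \<noteq> i \<Longrightarrow> qm i > qm j"
  shows "\<exists>\<beta>0>0. \<forall>\<beta>. (\<forall>j k. 0 \<le> \<beta> j k \<and> \<beta> j k \<le> \<beta>0) \<longrightarrow>
    (\<exists>\<eta>>0.
      (\<forall>t T x0 gT. t < T \<and> distribution x0 \<and> admissible_terminal i \<eta> gT \<longrightarrow>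
         (\<exists>x u g. mfg_solution lam qp qm w \<delta> \<beta> t T x0 gT x u g \<and>
            (\<forall>s\<in>{t..T}. u s = u_hat i) \<and>
            (\<forall>x' u' g'. mfg_solution lam qp qm w \<delta> \<beta> t T x0 gT x' u' g' \<and>
                (\<forall>s\<in>{t..T}. u' s = u_hat i) \<longrightarrow>
              (\<forall>s\<in>{t..T}. x' s = x s \<and> u' s = u s \<and> g' s = g s)))) \<and>
      (\<forall>\<epsilon>>0. \<exists>L\<ge>0.
         (\<forall>t T x0 gT x u g.
            t < T \<and> distribution x0 \<and> admissible_terminal i \<eta> gT \<and>
            mfg_solution lam qp qm w \<delta> \<beta> t T x0 gT x u g \<and> (\<forall>s\<in>{t..T}. u s = u_hat i) \<longrightarrow>
            (\<forall>s\<in>{t + L..T}. \<forall>z. \<bar>x s z - x_bar qp qm \<beta> i z\<bar> < \<epsilon>)) \<and>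
         (\<forall>gT. admissible_terminal i \<eta> gT \<longrightarrow>
            (\<exists>L'\<ge>0. \<forall>t T x0 x u g.
               t < T \<and> distribution x0 \<and>
               mfg_solution lam qp qm w \<delta> \<beta> t T x0 gT x u g \<and> (\<forall>s\<in>{t..T}. u s = u_hat i) \<longrightarrow>
               (\<forall>s\<in>{t + L..T - L'}. \<forall>z.
                  \<bar>g s z - g_bar lam qp qm w \<delta> \<beta> i z\<bar> < \<epsilon>)))))"
proof -
  define \<Gamma> where "\<Gamma> = (w (i, Infected) - w (i, Susceptible)) / (qm i + qp i + \<delta>)"
  \<comment> \<open>\<open>A j\<close> is the largest \<open>\<beta>0\<close> for which strategy \<open>j\<close> keeps its cost disadvantage in the susceptible
    state; the first term of the minimum makes the infected fraction contract.\<close>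
  define A where "A = (\<lambda>j. ((w (j, Susceptible) - w (i, Susceptible)) - (qm i - qm j) * \<Gamma>) / \<Gamma>)"
  define \<beta>0 where "\<beta>0 = Min (insert ((qp i + qm i) / 2) (A ` (UNIV - {i})))"
  have W: "0 < w (i, Infected) - w (i, Susceptible)"
    using assms(5)[of i] by simp
  have rate: "0 < qm i + qp i + \<delta>"
    using assms(1) assms(3)[of i] assms(4)[of i] by simp
  have \<Gamma>: "0 < \<Gamma>"
    using W rate by (simp add: \<Gamma>_def)
  have rescale: "a * \<Gamma> < c" if "a / (qm i + qp i + \<delta>) < c / (w (i, Infected) - w (i, Susceptible))" for a c
    using that W rate by (simp add: \<Gamma>_def field_simps)
  have infected: "(qp j - qp i) * \<Gamma> < w (j, Infected) - w (i, Infected)"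
    and susceptible: "(qm i - qm j) * \<Gamma> < w (j, Susceptible) - w (i, Susceptible)" if "j \<noteq> i" for j
    using rescale assms(6,7)[OF that] by auto
  have "0 < A j" if "j \<noteq> i" for j
    using susceptible[OF that] \<Gamma> by (simp add: A_def)
  then have \<beta>0: "0 < \<beta>0"
    using assms(3)[of i] assms(4)[of i] by (auto simp: \<beta>0_def)
  have \<beta>0_le: "\<beta>0 \<le> (qp i + qm i) / 2" "\<And>j. j \<noteq> i \<Longrightarrow> \<beta>0 \<le> A j"
    unfolding \<beta>0_def by (rule Min_le; simp)+
  show ?thesis
  proof (rule exI[of _ \<beta>0], intro conjI allI impI \<beta>0)
    fix \<beta> :: "'d \<Rightarrow> 'd \<Rightarrow> real" assume \<beta>: "\<forall>j k. 0 \<le> \<beta> j k \<and> \<beta> j k \<le> \<beta>0"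
    have sus: "(qm i - qm j + \<beta>0) * \<Gamma> \<le> w (j, Susceptible) - w (i, Susceptible)" if "j \<noteq> i" for j
    proof -
      have "\<beta>0 * \<Gamma> \<le> A j * \<Gamma>"
        using \<beta>0_le(2)[OF that] \<Gamma> by (intro mult_right_mono) auto
      also have "A j * \<Gamma> = w (j, Susceptible) - w (i, Susceptible) - (qm i - qm j) * \<Gamma>"
        using \<Gamma> by (simp add: A_def)
      finally show ?thesis by (simp add: algebra_simps)
    qed
    interpret dominant_strategy lam \<delta> \<beta>0 qp qm w \<beta> i
    proof
      show "qp i \<le> qp j" "qm j \<le> qm i" for j
        using assms(8,9)[of j] by (cases "j = i"; simp)+
      show "\<beta>0 < qp i + qm i"
      proof (rule le_less_trans[OF \<beta>0_le(1)])
        have "0 < qp i + qm i" using assms(3)[of i] assms(4)[of i] by (rule add_pos_pos)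
        then show "(qp i + qm i) / 2 < qp i + qm i" by simp
      qed
    qed (use assms \<beta> infected sus in \<open>auto simp: \<Gamma>_def less_imp_le\<close>)
    show "\<exists>\<eta>>0.
      (\<forall>t T x0 gT. t < T \<and> distribution x0 \<and> admissible_terminal i \<eta> gT \<longrightarrow>
         (\<exists>x u g. mfg_solution lam qp qm w \<delta> \<beta> t T x0 gT x u g \<and>
            (\<forall>s\<in>{t..T}. u s = u_hat i) \<and>
            (\<forall>x' u' g'. mfg_solution lam qp qm w \<delta> \<beta> t T x0 gT x' u' g' \<and>
                (\<forall>s\<in>{t..T}. u' s = u_hat i) \<longrightarrow>
              (\<forall>s\<in>{t..T}. x' s = x s \<and> u' s = u s \<and> g' s = g s)))) \<and>
      (\<forall>\<epsilon>>0. \<exists>L\<ge>0.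
         (\<forall>t T x0 gT x u g.
            t < T \<and> distribution x0 \<and> admissible_terminal i \<eta> gT \<and>
            mfg_solution lam qp qm w \<delta> \<beta> t T x0 gT x u g \<and> (\<forall>s\<in>{t..T}. u s = u_hat i) \<longrightarrow>
            (\<forall>s\<in>{t + L..T}. \<forall>z. \<bar>x s z - x_bar qp qm \<beta> i z\<bar> < \<epsilon>)) \<and>
         (\<forall>gT. admissible_terminal i \<eta> gT \<longrightarrow>
            (\<exists>L'\<ge>0. \<forall>t T x0 x u g.
               t < T \<and> distribution x0 \<and>
               mfg_solution lam qp qm w \<delta> \<beta> t T x0 gT x u g \<and> (\<forall>s\<in>{t..T}. u s = u_hat i) \<longrightarrow>
               (\<forall>s\<in>{t + L..T - L'}. \<forall>z.
                  \<bar>g s z - g_bar lam qp qm w \<delta> \<beta> i z\<bar> < \<epsilon>))))"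
    proof (rule exI[of _ gap_bound], rule conjI[OF gap_bound_pos], rule conjI)
      show "\<forall>t T x0 gT. t < T \<and> distribution x0 \<and> admissible_terminal i gap_bound gT \<longrightarrow>
         (\<exists>x u g. mfg_solution lam qp qm w \<delta> \<beta> t T x0 gT x u g \<and>
            (\<forall>s\<in>{t..T}. u s = u_hat i) \<and>
            (\<forall>x' u' g'. mfg_solution lam qp qm w \<delta> \<beta> t T x0 gT x' u' g' \<and>
                (\<forall>s\<in>{t..T}. u' s = u_hat i) \<longrightarrow>
              (\<forall>s\<in>{t..T}. x' s = x s \<and> u' s = u s \<and> g' s = g s)))"
      proof (intro allI impI, elim conjE)
        fix t T :: real and x0 gT :: "'d state \<Rightarrow> real"
        assume "t < T" "distribution x0" "admissible_terminal i gap_bound gT"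
        then obtain x g where sol: "mfg_solution lam qp qm w \<delta> \<beta> t T x0 gT x (\<lambda>_. u_hat i) g"
          using equilibrium_exists by blast
        have "x' s = x s \<and> u' s = u_hat i \<and> g' s = g s"
          if "mfg_solution lam qp qm w \<delta> \<beta> t T x0 gT x' u' g'" "\<forall>s\<in>{t..T}. u' s = u_hat i" "s \<in> {t..T}"
          for x' u' g' s
          using equilibrium_unique[OF sol _ that] that by blast
        then show "\<exists>x u g. mfg_solution lam qp qm w \<delta> \<beta> t T x0 gT x u g \<and>
            (\<forall>s\<in>{t..T}. u s = u_hat i) \<and>
            (\<forall>x' u' g'. mfg_solution lam qp qm w \<delta> \<beta> t T x0 gT x' u' g' \<and>
                (\<forall>s\<in>{t..T}. u' s = u_hat i) \<longrightarrow>
              (\<forall>s\<in>{t..T}. x' s = x s \<and> u' s = u s \<and> g' s = g s))"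
          using sol by (intro exI[of _ x] exI[of _ "\<lambda>_. u_hat i"] exI[of _ g]) blast
      qed
    next
      have paths: "population_path t T x" "payoff_path t T (\<lambda>s. pressure (x s)) g" "g T = gT"
        if "mfg_solution lam qp qm w \<delta> \<beta> t T x0 gT x u g" "\<forall>s\<in>{t..T}. u s = u_hat i" for t T x0 gT x u g
        using that(1)[unfolded mfg_solution_u_hat_iff[OF that(2)]] by auto
      show "\<forall>\<epsilon>>0. \<exists>L\<ge>0.
         (\<forall>t T x0 gT x u g.
            t < T \<and> distribution x0 \<and> admissible_terminal i gap_bound gT \<and>
            mfg_solution lam qp qm w \<delta> \<beta> t T x0 gT x u g \<and> (\<forall>s\<in>{t..T}. u s = u_hat i) \<longrightarrow>
            (\<forall>s\<in>{t + L..T}. \<forall>z. \<bar>x s z - x_bar qp qm \<beta> i z\<bar> < \<epsilon>)) \<and>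
         (\<forall>gT. admissible_terminal i gap_bound gT \<longrightarrow>
            (\<exists>L'\<ge>0. \<forall>t T x0 x u g.
               t < T \<and> distribution x0 \<and>
               mfg_solution lam qp qm w \<delta> \<beta> t T x0 gT x u g \<and> (\<forall>s\<in>{t..T}. u s = u_hat i) \<longrightarrow>
               (\<forall>s\<in>{t + L..T - L'}. \<forall>z.
                  \<bar>g s z - g_bar lam qp qm w \<delta> \<beta> i z\<bar> < \<epsilon>)))"
      proof (intro allI impI)
        fix \<epsilon> :: real assume \<epsilon>: "0 < \<epsilon>"
        obtain L1 where L1: "0 \<le> L1" "\<And>t T x s z. population_path t T x \<Longrightarrow> s \<in> {t + L1..T} \<Longrightarrow>
            \<bar>x s z - x_bar qp qm \<beta> i z\<bar> < \<epsilon>"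
          using population_converges[OF \<epsilon>] by blast
        obtain L2 where L2: "0 \<le> L2" "\<And>gT. \<exists>L'\<ge>0. \<forall>t T x g. population_path t T x \<longrightarrow>
            payoff_path t T (\<lambda>s. pressure (x s)) g \<longrightarrow> g T = gT \<longrightarrow>
            (\<forall>s\<in>{t + L2..T - L'}. \<forall>z. \<bar>g s z - g_bar lam qp qm w \<delta> \<beta> i z\<bar> < \<epsilon>)"
          using payoff_turnpike[OF \<epsilon>] by blast
        define L where "L = max L1 L2"
        have L: "0 \<le> L" "L1 \<le> L" "L2 \<le> L"
          using L1(1) by (auto simp: L_def)
        have population: "\<bar>x s z - x_bar qp qm \<beta> i z\<bar> < \<epsilon>"
          if "mfg_solution lam qp qm w \<delta> \<beta> t T x0 gT x u g" "\<forall>s\<in>{t..T}. u s = u_hat i" "s \<in> {t + L..T}"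
          for t T x0 gT x u g s z
          by (rule L1(2)[OF paths(1)[OF that(1,2)]]) (use that(3) L in auto)
        have payoff: "\<exists>L'\<ge>0. \<forall>t T x0 x u g.
               t < T \<and> distribution x0 \<and>
               mfg_solution lam qp qm w \<delta> \<beta> t T x0 gT x u g \<and> (\<forall>s\<in>{t..T}. u s = u_hat i) \<longrightarrow>
               (\<forall>s\<in>{t + L..T - L'}. \<forall>z. \<bar>g s z - g_bar lam qp qm w \<delta> \<beta> i z\<bar> < \<epsilon>)" for gT
        proof -
          obtain L' where L': "0 \<le> L'" "\<forall>t T x g. population_path t T x \<longrightarrow>
              payoff_path t T (\<lambda>s. pressure (x s)) g \<longrightarrow> g T = gT \<longrightarrow>
              (\<forall>s\<in>{t + L2..T - L'}. \<forall>z. \<bar>g s z - g_bar lam qp qm w \<delta> \<beta> i z\<bar> < \<epsilon>)"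
            using L2(2)[of gT] by (elim exE conjE)
          show ?thesis
          proof (intro exI[of _ L'] conjI L'(1) allI impI ballI, elim conjE)
            fix t T x0 x u g s z
            assume "mfg_solution lam qp qm w \<delta> \<beta> t T x0 gT x u g" "\<forall>s\<in>{t..T}. u s = u_hat i"
              and "s \<in> {t + L..T - L'}"
            then show "\<bar>g s z - g_bar lam qp qm w \<delta> \<beta> i z\<bar> < \<epsilon>"
              using L by (intro L'(2)[rule_format, OF paths]) auto
          qed
        qed
        show "\<exists>L\<ge>0.
         (\<forall>t T x0 gT x u g.
            t < T \<and> distribution x0 \<and> admissible_terminal i gap_bound gT \<and>
            mfg_solution lam qp qm w \<delta> \<beta> t T x0 gT x u g \<and> (\<forall>s\<in>{t..T}. u s = u_hat i) \<longrightarrow>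
            (\<forall>s\<in>{t + L..T}. \<forall>z. \<bar>x s z - x_bar qp qm \<beta> i z\<bar> < \<epsilon>)) \<and>
         (\<forall>gT. admissible_terminal i gap_bound gT \<longrightarrow>
            (\<exists>L'\<ge>0. \<forall>t T x0 x u g.
               t < T \<and> distribution x0 \<and>
               mfg_solution lam qp qm w \<delta> \<beta> t T x0 gT x u g \<and> (\<forall>s\<in>{t..T}. u s = u_hat i) \<longrightarrow>
               (\<forall>s\<in>{t + L..T - L'}. \<forall>z.
                  \<bar>g s z - g_bar lam qp qm w \<delta> \<beta> i z\<bar> < \<epsilon>)))"
        proof (rule exI[of _ L], intro conjI allI impI)
          show "0 \<le> L" by (rule L(1))
          show "\<exists>L'\<ge>0. \<forall>t T x0 x u g.
               t < T \<and> distribution x0 \<and>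
               mfg_solution lam qp qm w \<delta> \<beta> t T x0 gT x u g \<and> (\<forall>s\<in>{t..T}. u s = u_hat i) \<longrightarrow>
               (\<forall>s\<in>{t + L..T - L'}. \<forall>z. \<bar>g s z - g_bar lam qp qm w \<delta> \<beta> i z\<bar> < \<epsilon>)" for gT
            by (rule payoff)
        qed (use population in blast)
      qed
    qed
  qed
qed

end
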